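(* Let $q=2$. Let $A=\begin{pmatrix}a_{11} & a_{12} \\ a_{21} & 0\end{pmatrix}$ with entries in $\mathbb{C}_\infty$, $\operatorname{ord}a_{11}=-1$, $a_{21}\neq0$, and put $v=\operatorname{ord}a_{21}$ and $t=\operatorname{ord}\left(\frac{\theta^2}{a_{21}}+\frac{\theta^4}{a_{21}^4}-a_{12}^2\right)$. If $0\le v<2$ and $t\ge-\frac{16}7v-\frac{24}7$, then $h^1(M(A))=4$.
   Context: Let $q=2$ and $\theta$ a variable. $\mathbb{C}_\infty$ is the completion of an algebraic closure of the completion of $\mathbb{F}_q(\theta)$ at the valuation at infinity $\operatorname{ord}$, normalized by $\operatorname{ord}\theta=-1$ (and $\operatorname{ord}0=+\infty$). $\mathbb{C}_\infty[T,\tau]$ is the ring of non-commutative polynomials with relations $Ta=aT$, $T\tau=\tau T$, $\tau a=a^q\tau$ for $a\in\mathbb{C}_\infty$; $\mathbb{C}_\infty\{\tau\}$ is the subring generated over $\mathbb{C}_\infty$ by $\tau$. For a $2\times2$ matrix $A$ over $\mathbb{C}_\infty$, $M(A)$ is the left $\mathbb{C}_\infty[T,\tau]$-module (Anderson t-motive of dimension 2 and rank 4) which is free over $\mathbb{C}_\infty\{\tau\}$ with basis $e_1,e_2$, where multiplication by $T$ is given, for the column $e_*=(e_1,e_2)^t$, by $Te_*=\theta e_*+A\tau e_*+\tau^2e_*$. It is free of rank 4 over $\mathbb{C}_\infty[T]$. $\mathbb{C}_\infty\{T\}$ is the ring of power series $\sum_{i\ge0}a_iT^i$ with $a_i\in\mathbb{C}_\infty$,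 $a_i\to0$, on which $\tau$ acts by $\tau(\sum a_iT^i)=\sum a_i^qT^i$. On $M\otimes_{\mathbb{C}_\infty[T]}\mathbb{C}_\infty\{T\}$, $\tau$ acts by $\tau(m\otimes f)=\tau(m)\otimes\tau(f)$. $H^1(M)$ is the $\mathbb{F}_q[T]$-module of $\tau$-invariant elements of $M\otimes_{\mathbb{C}_\infty[T]}\mathbb{C}_\infty\{T\}$; it is free, and $h^1(M)$ is its rank over $\mathbb{F}_q[T]$. *)

theory Defs
  imports
    "HOL-Analysis.Analysis"
    "HOL-Algebra.Free_Abelian_Groups"
    "HOL-Algebra.Generated_Groups"
    "HOL-Library.Z2"
    "HOL-Computational_Algebra.Polynomial_FPS"
begin

section \<open>The field of coefficients\<close>

text \<open>Throughout, \<open>q = 2\<close>, the field with \<open>q\<close> elements is the type \<open>bit\<close>, and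
  \<open>of_bit\<close> embeds it into any field of characteristic 2.\<close>

definition is_valuation :: "('a::field \<Rightarrow> ereal) \<Rightarrow> bool" where
  "is_valuation ord \<longleftrightarrow>
     (\<forall>x. ord x \<noteq> -\<infinity>) \<and>
     (\<forall>x. ord x = \<infinity> \<longleftrightarrow> x = 0) \<and>
     (\<forall>x y. ord (x * y) = ord x + ord y) \<and>
     (\<forall>x y. ord (x + y) \<ge> min (ord x) (ord y))"

definition val_complete :: "('a::field \<Rightarrow> ereal) \<Rightarrow> bool" where
  "val_complete ord \<longleftrightarrow>
     (\<forall>X :: nat \<Rightarrow> 'a.
        (\<forall>r::real. \<exists>N. \<forall>m\<ge>N. \<forall>n\<ge>N. ord (X m - X n) > ereal r)
        \<longrightarrow> (\<exists>x. (\<lambda>n. ord (X n - x)) \<longlonglongrightarrow> \<infinity>))"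

definition val_closure :: "('a::field \<Rightarrow> ereal) \<Rightarrow> 'a set \<Rightarrow> 'a set" where
  "val_closure ord S = {x. \<forall>r::real. \<exists>s\<in>S. ord (x - s) > ereal r}"

definition algebraic_over :: "'a::field set \<Rightarrow> 'a set" where
  "algebraic_over L = {x. \<exists>p. p \<noteq> 0 \<and> set (coeffs p) \<subseteq> L \<and> poly p x = 0}"

definition alg_closed_subfield :: "'a::field set \<Rightarrow> bool" where
  "alg_closed_subfield L \<longleftrightarrow>
     (\<forall>p. set (coeffs p) \<subseteq> L \<and> degree p > 0 \<longrightarrow> (\<exists>x\<in>L. poly p x = 0))"

definition F2_poly :: "bit poly \<Rightarrow> 'a::field poly" where
  "F2_poly = map_poly of_bit"

definition F2_rational :: "'a::field \<Rightarrow> 'a set" where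
  "F2_rational \<theta> = {poly (F2_poly g) \<theta> / poly (F2_poly h) \<theta> | g h. poly (F2_poly h) \<theta> \<noteq> 0}"

text \<open>\<open>is_C_infinity ord \<theta>\<close> says that the whole field \<open>'a\<close>, with the valuation \<open>ord\<close>, is a
  completion of an algebraic closure of the completion of the field generated by \<open>\<theta>\<close> over the
  field with 2 elements. Since \<open>'a\<close> is complete, the closure \<open>L\<close> of that subfield is its
  completion. The conditions \<open>CHAR('a) = 2\<close> and \<open>ord \<theta> = -1\<close> force \<open>\<theta>\<close> to be
  transcendental over the prime field and \<open>ord\<close> to be the valuation at infinity on the rational
  functions in \<open>\<theta>\<close>; its extension to \<open>'a\<close> is then unique. The values of \<open>ord\<close> on nonzero
  elements are rational numbers, not only integers.\<close>

definition is_C_infinity :: "('a::field \<Rightarrow> ereal) \<Rightarrow> 'a \<Rightarrow> bool" where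
  "is_C_infinity ord \<theta> \<longleftrightarrow>
     CHAR('a) = 2 \<and> is_valuation ord \<and> ord \<theta> = -1 \<and> val_complete ord \<and>
     (let L = val_closure ord (F2_rational \<theta>); Lalg = algebraic_over L
      in alg_closed_subfield Lalg \<and> val_closure ord Lalg = UNIV)"


section \<open>The t-motive\<close>

text \<open>An element \<open>\<Sum>i. a\<^sub>i \<tau>\<^sup>i\<close> of the ring of twisted polynomials in \<open>\<tau>\<close> is
  represented by the polynomial with coefficients \<open>a\<^sub>i\<close>. Only the additive structure of the
  polynomial type is used (its product is not that of the twisted polynomials).
  A vector \<open>m\<close> with two such entries stands for \<open>m\<^sub>1 e\<^sub>1 + m\<^sub>2 e\<^sub>2\<close>. Thus the additive
  group of \<open>M(A)\<close> is the type \<open>'a poly ^ 2\<close>, and its structure of left module over the ring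
  of polynomials in \<open>T\<close> and \<open>\<tau>\<close> is given by the actions of the scalars, of \<open>\<tau>\<close> and of
  \<open>T\<close>.\<close>

type_synonym 'a motive = "'a poly ^ 2"

definition motive_basis :: "2 \<Rightarrow> 'a::field motive" where
  "motive_basis j = axis j 1"

definition motive_scale :: "'a::field \<Rightarrow> 'a motive \<Rightarrow> 'a motive" where
  "motive_scale c m = (\<chi> j. smult c (m $ j))"

text \<open>Left multiplication by \<open>\<tau>\<close>: \<open>\<tau> \<cdot> a \<tau>\<^sup>i = a\<^sup>2 \<tau>\<^bsup>i+1\<^esup>\<close>.\<close>

definition motive_tau :: "'a::field motive \<Rightarrow> 'a motive" where
  "motive_tau m = (\<chi> j. pCons 0 (map_poly (\<lambda>a. a ^ 2) (m $ j)))"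

definition twisted_act :: "'a::field poly \<Rightarrow> 'a motive \<Rightarrow> 'a motive" where
  "twisted_act P m = (\<Sum>i\<le>degree P. motive_scale (coeff P i) ((motive_tau ^^ i) m))"

definition motive_T_basis :: "'a::field \<Rightarrow> 'a ^ 2 ^ 2 \<Rightarrow> 2 \<Rightarrow> 'a motive" where
  "motive_T_basis \<theta> A j =
     motive_scale \<theta> (motive_basis j)
     + (\<Sum>k\<in>UNIV. motive_scale (A $ j $ k) (motive_tau (motive_basis k)))
     + motive_tau (motive_tau (motive_basis j))"

text \<open>\<open>T\<close> commutes with the twisted polynomials, so it is determined by its values on the
  basis.\<close>

definition motive_T :: "'a::field \<Rightarrow> 'a ^ 2 ^ 2 \<Rightarrow> 'a motive \<Rightarrow> 'a motive" where
  "motive_T \<theta> A m = (\<Sum>j\<in>UNIV. twisted_act (m $ j) (motive_T_basis \<theta> A j))"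

definition motive_poly_act :: "'a::field \<Rightarrow> 'a ^ 2 ^ 2 \<Rightarrow> 'a poly \<Rightarrow> 'a motive \<Rightarrow> 'a motive" where
  "motive_poly_act \<theta> A p m = (\<Sum>i\<le>degree p. motive_scale (coeff p i) ((motive_T \<theta> A ^^ i) m))"


section \<open>Restricted power series\<close>

definition tate :: "('a::field \<Rightarrow> ereal) \<Rightarrow> 'a fps set" where
  "tate ord = {f. (\<lambda>n. ord (fps_nth f n)) \<longlonglongrightarrow> \<infinity>}"

definition tate_tau :: "'a::field fps \<Rightarrow> 'a fps" where
  "tate_tau f = Abs_fps (\<lambda>n. (fps_nth f n) ^ 2)"


section \<open>Tensor products\<close>

text \<open>The tensor product, over a commutative ring \<open>'r\<close>, of a module with underlying group \<open>'m\<close>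
  and a module with underlying additive group \<open>N \<subseteq> 'n\<close>, the actions of \<open>'r\<close> being
  \<open>actM\<close> and \<open>actN\<close>: the quotient of the free abelian group on \<open>UNIV \<times> N\<close> by the usual
  relations. In keeping with the conventions of \<open>free_Abelian_group\<close>, its addition is written
  multiplicatively.\<close>

definition tensor_relations ::
  "('r \<Rightarrow> 'm \<Rightarrow> 'm) \<Rightarrow> ('r \<Rightarrow> 'n \<Rightarrow> 'n) \<Rightarrow> 'n set
    \<Rightarrow> (('m::ab_group_add \<times> 'n::ab_group_add) \<Rightarrow>\<^sub>0 int) set" where
  "tensor_relations actM actN N =
     {frag_of (m + m', n) - frag_of (m, n) - frag_of (m', n) | m m' n. n \<in> N} \<union>
     {frag_of (m, n + n') - frag_of (m, n) - frag_of (m, n') | m n n'. n \<in> N \<and> n' \<in> N} \<union>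
     {frag_of (actM r m, n) - frag_of (m, actN r n) | r m n. n \<in> N}"

definition tensor_null ::
  "('r \<Rightarrow> 'm \<Rightarrow> 'm) \<Rightarrow> ('r \<Rightarrow> 'n \<Rightarrow> 'n) \<Rightarrow> 'n set
    \<Rightarrow> (('m::ab_group_add \<times> 'n::ab_group_add) \<Rightarrow>\<^sub>0 int) set" where
  "tensor_null actM actN N =
     generate (free_Abelian_group (UNIV \<times> N)) (tensor_relations actM actN N)"

definition tensor_product ::
  "('r \<Rightarrow> 'm \<Rightarrow> 'm) \<Rightarrow> ('r \<Rightarrow> 'n \<Rightarrow> 'n) \<Rightarrow> 'n set
    \<Rightarrow> (('m::ab_group_add \<times> 'n::ab_group_add) \<Rightarrow>\<^sub>0 int) set monoid" where
  "tensor_product actM actN N =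
     free_Abelian_group (UNIV \<times> N) Mod tensor_null actM actN N"

text \<open>The additive map \<open>m \<otimes> n \<mapsto> u m \<otimes> w n\<close> on cosets (for \<open>u\<close> and \<open>w\<close> for which it is
  well defined).\<close>

definition tensor_map ::
  "('r \<Rightarrow> 'm \<Rightarrow> 'm) \<Rightarrow> ('r \<Rightarrow> 'n \<Rightarrow> 'n) \<Rightarrow> 'n set \<Rightarrow> ('m \<Rightarrow> 'm) \<Rightarrow> ('n \<Rightarrow> 'n)
    \<Rightarrow> (('m::ab_group_add \<times> 'n::ab_group_add) \<Rightarrow>\<^sub>0 int) set \<Rightarrow> (('m \<times> 'n) \<Rightarrow>\<^sub>0 int) set" where
  "tensor_map actM actN N u w X =
     (\<Union>x\<in>X. tensor_null actM actN N #>\<^bsub>free_Abelian_group (UNIV \<times> N)\<^esub>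
        frag_extend (\<lambda>(m, n). frag_of (u m, w n)) x)"


section \<open>The module \<open>H\<^sup>1(M(A))\<close> and its rank\<close>

type_synonym 'a motive_tensor = "(('a motive \<times> 'a fps) \<Rightarrow>\<^sub>0 int) set"

definition fps_poly_act :: "'a::field poly \<Rightarrow> 'a fps \<Rightarrow> 'a fps" where
  "fps_poly_act p f = fps_of_poly p * f"

definition motive_tate ::
  "('a::field \<Rightarrow> ereal) \<Rightarrow> 'a \<Rightarrow> 'a ^ 2 ^ 2 \<Rightarrow> 'a motive_tensor monoid" where
  "motive_tate ord \<theta> A = tensor_product (motive_poly_act \<theta> A) fps_poly_act (tate ord)"

definition motive_tate_tau ::
  "('a::field \<Rightarrow> ereal) \<Rightarrow> 'a \<Rightarrow> 'a ^ 2 ^ 2 \<Rightarrow> 'a motive_tensor \<Rightarrow> 'a motive_tensor" where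
  "motive_tate_tau ord \<theta> A =
     tensor_map (motive_poly_act \<theta> A) fps_poly_act (tate ord) motive_tau tate_tau"

definition motive_tate_act ::
  "('a::field \<Rightarrow> ereal) \<Rightarrow> 'a \<Rightarrow> 'a ^ 2 ^ 2 \<Rightarrow> bit poly \<Rightarrow> 'a motive_tensor \<Rightarrow> 'a motive_tensor" where
  "motive_tate_act ord \<theta> A g =
     tensor_map (motive_poly_act \<theta> A) fps_poly_act (tate ord) id (fps_poly_act (F2_poly g))"

definition H1 :: "('a::field \<Rightarrow> ereal) \<Rightarrow> 'a \<Rightarrow> 'a ^ 2 ^ 2 \<Rightarrow> 'a motive_tensor set" where
  "H1 ord \<theta> A = {x \<in> carrier (motive_tate ord \<theta> A). motive_tate_tau ord \<theta> A x = x}"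

text \<open>Here \<open>finprod\<close> is the sum \<open>\<Sum>b\<in>B. g b \<cdot> b\<close> in the additive group of the tensor
  product.\<close>

definition is_H1_basis ::
  "('a::field \<Rightarrow> ereal) \<Rightarrow> 'a \<Rightarrow> 'a ^ 2 ^ 2 \<Rightarrow> 'a motive_tensor set \<Rightarrow> bool" where
  "is_H1_basis ord \<theta> A B \<longleftrightarrow>
     finite B \<and> B \<subseteq> H1 ord \<theta> A \<and>
     (\<forall>x\<in>H1 ord \<theta> A. \<exists>!g. g \<in> B \<rightarrow>\<^sub>E (UNIV :: bit poly set) \<and>
        x = finprod (motive_tate ord \<theta> A) (\<lambda>b. motive_tate_act ord \<theta> A (g b) b) B)"

definition h1 :: "('a::field \<Rightarrow> ereal) \<Rightarrow> 'a \<Rightarrow> 'a ^ 2 ^ 2 \<Rightarrow> nat" where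
  "h1 ord \<theta> A = (THE n. \<exists>B. is_H1_basis ord \<theta> A B \<and> card B = n)"

end

theory Submission
  imports Defs
begin

text \<open>In the basis \<open>e\<^sub>1, e\<^sub>2, \<tau> e\<^sub>1, \<tau> e\<^sub>2\<close> over the polynomials in \<open>T\<close>, a \<open>\<tau>\<close>-invariant element
  amounts to two restricted power series \<open>\<Sum>n. x\<^sub>n T\<^sup>n\<close> and \<open>\<Sum>n. y\<^sub>n T\<^sup>n\<close> with
  \<open>\<theta>\<^sup>2 x\<^sub>n\<^sup>4 + a\<^sub>1\<^sub>1 x\<^sub>n\<^sup>2 + a\<^sub>2\<^sub>1 y\<^sub>n\<^sup>2 + x\<^sub>n = p\<close> and \<open>\<theta>\<^sup>2 y\<^sub>n\<^sup>4 + a\<^sub>1\<^sub>2 x\<^sub>n\<^sup>2 + y\<^sub>n = q\<close>, where \<open>p\<close> and \<open>q\<close>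
  are the fourth powers of \<open>x\<^sub>n\<^sub>-\<^sub>1\<close> and \<open>y\<^sub>n\<^sub>-\<^sub>1\<close>. Elimination of \<open>y\<^sub>n\<close> gives \<open>F(x\<^sub>n) = w\<close> for a separable
  additive polynomial \<open>F\<close> of degree 16, whose coefficient of \<open>x\<^sup>4\<close> has valuation \<open>t\<close>. The bound on
  \<open>t\<close> says that this coefficient lies above the Newton polygon of the others, so that the nonzero
  roots of \<open>F\<close> have valuation \<open>1/2\<close> or \<open>\<alpha> = (8 + 3 v) / 7\<close>. If \<open>ord x\<^sub>n \<ge> \<xi>\<close> and
  \<open>ord y\<^sub>n \<ge> (\<xi> - v) / 2\<close>, the largest root \<open>x\<^sub>n\<^sub>+\<^sub>1\<close> has valuation at least
  \<open>4 \<xi> - 3 v\<close> and \<open>1 + \<xi> / 2\<close>, one of which exceeds \<open>\<xi>\<close> by \<open>(2 - v) / 4\<close>. Hence each of the 16 roots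
  of \<open>F\<close> is the constant coefficient of an invariant element with smaller further coefficients,
  and lifts of a basis of the roots adapted to the two valuations form a basis of \<open>H\<^sup>1\<close>.\<close>

section \<open>Valued fields\<close>

locale valued_field =
  fixes ord :: "'a::field \<Rightarrow> ereal"
  assumes valuation: "is_valuation ord"
begin

lemma ord_neq_MInf [simp]: "ord x \<noteq> -\<infinity>"
  using valuation by (auto simp: is_valuation_def)

lemma ord_eq_PInf_iff [simp]: "ord x = \<infinity> \<longleftrightarrow> x = 0"
  using valuation by (auto simp: is_valuation_def)

lemma ord_0 [simp]: "ord 0 = \<infinity>"
  by simp

lemma ord_mult: "ord (x * y) = ord x + ord y"
  using valuation by (auto simp: is_valuation_def)

lemma ord_add: "min (ord x) (ord y) \<le> ord (x + y)"
  using valuation by (auto simp: is_valuation_def)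

lemma ord_finite:
  assumes "x \<noteq> 0"
  obtains r where "ord x = ereal r"
  using assms by (cases "ord x") auto

lemma ord_1 [simp]: "ord 1 = 0"
proof -
  have "ord 1 = ord 1 + ord 1" using ord_mult[of 1 1] by simp
  moreover obtain r where "ord 1 = ereal r" using ord_finite[of 1] by auto
  ultimately show ?thesis by simp
qed

lemma ord_minus [simp]: "ord (- x) = ord x"
proof -
  have "ord (-1) + ord (-1) = 0" using ord_mult[of "-1" "-1"] by simp
  moreover obtain r where "ord (-1) = ereal r" using ord_finite[of "-1"] by auto
  ultimately have "ord (-1) = 0" by (simp add: zero_ereal_def)
  then show ?thesis using ord_mult[of "-1" x] by simp
qed

lemma ord_add_ge: "r \<le> ord x \<Longrightarrow> r \<le> ord y \<Longrightarrow> r \<le> ord (x + y)"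
  using ord_add[of x y] by (metis min.bounded_iff order_trans)

lemma ord_diff_ge: "r \<le> ord x \<Longrightarrow> r \<le> ord y \<Longrightarrow> r \<le> ord (x - y)"
  using ord_add_ge[of r x "-y"] by simp

lemma ord_add_gt: "r < ord x \<Longrightarrow> r < ord y \<Longrightarrow> r < ord (x + y)"
  using ord_add[of x y] by (metis min_less_iff_conj order_less_le_trans)

lemma ord_diff_gt: "r < ord x \<Longrightarrow> r < ord y \<Longrightarrow> r < ord (x - y)"
  using ord_add_gt[of r x "-y"] by simp

lemma ord_sum_ge: "(\<And>i. i \<in> I \<Longrightarrow> r \<le> ord (f i)) \<Longrightarrow> r \<le> ord (sum f I)"
  by (induction I rule: infinite_finite_induct) (auto intro: ord_add_ge)

lemma ord_sum_gt: "(\<And>i. i \<in> I \<Longrightarrow> r < ord (f i)) \<Longrightarrow> r < \<infinity> \<Longrightarrow> r < ord (sum f I)"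
  by (induction I rule: infinite_finite_induct) (auto intro: ord_add_gt)

lemma ord_mult_ge: "ereal r \<le> ord x \<Longrightarrow> ereal s \<le> ord y \<Longrightarrow> ereal (r + s) \<le> ord (x * y)"
  unfolding ord_mult plus_ereal.simps(1)[symmetric] by (rule add_mono)

lemma ord_power_ge: "ereal r \<le> ord x \<Longrightarrow> ereal (real n * r) \<le> ord (x ^ n)"
proof (induction n)
  case (Suc n)
  then show ?case using ord_mult_ge[of r x "real n * r" "x ^ n"] by (simp add: algebra_simps)
qed simp

lemma ord_power: "ord x = ereal r \<Longrightarrow> ord (x ^ n) = ereal (real n * r)"
  by (induction n) (auto simp: ord_mult algebra_simps)

lemma ord_inverse: 
  assumes "ord x = ereal r"
  shows "ord (inverse x) = ereal (- r)"
proof -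
  have "x \<noteq> 0" using assms by auto
  then have *: "ord x + ord (inverse x) = 0" by (simp flip: ord_mult)
  obtain s where s: "ord (inverse x) = ereal s" using ord_finite[of "inverse x"] \<open>x \<noteq> 0\<close> by auto
  from * show ?thesis unfolding s assms by (simp add: zero_ereal_def)
qed

lemma ord_divide: "ord x = ereal r \<Longrightarrow> ord y = ereal s \<Longrightarrow> ord (x / y) = ereal (r - s)"
  by (simp add: divide_inverse ord_mult ord_inverse)

lemma ord_divide_ge: "ereal r \<le> ord x \<Longrightarrow> ord y = ereal s \<Longrightarrow> ereal (r - s) \<le> ord (x / y)"
  using ord_mult_ge[of r x "-s" "inverse y"] by (simp add: divide_inverse ord_inverse)

lemma ord_eqI_unbounded: "(\<And>r. ereal r \<le> ord x) \<Longrightarrow> x = 0"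
  using ord_eq_PInf_iff ereal_top by blast

section \<open>Newton polygons: valuations of roots against valuations of coefficients\<close>

text \<open>If term \<open>i\<close> were strictly dominant, the other terms would sum to
  \<open>- f i\<close> although each of them has larger valuation.\<close>

lemma ord_dominant_term:
  assumes "finite I" "i \<in> I" "sum f I = 0" "f i \<noteq> 0"
  obtains j where "j \<in> I" "j \<noteq> i" "ord (f j) \<le> ord (f i)"
proof (rule ccontr)
  assume "\<not> thesis"
  then have less: "ord (f i) < ord (f j)" if "j \<in> I - {i}" for j
    using that assms by (metis Diff_iff insertI1 not_le \<open>\<And>j. \<lbrakk>j \<in> I; j \<noteq> i; ord (f j) \<le> ord (f i)\<rbrakk> \<Longrightarrow> thesis\<close>)
  have "ord (f i) < \<infinity>" using assms(4) by (simp add: less_top[symmetric] top_ereal_def)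
  with less have "ord (f i) < ord (sum f (I - {i}))" by (intro ord_sum_gt)
  moreover have "sum f (I - {i}) = - f i"
    using assms(1-3) by (simp add: sum_diff1)
  ultimately show False by simp
qed

lemma ord_poly_ge:
  assumes "\<And>i. ereal m \<le> ord (coeff p i)" "ereal \<rho> \<le> ord x" "\<rho> \<le> 0" "degree p \<le> d"
  shows "ereal (m + real d * \<rho>) \<le> ord (poly p x)"
  unfolding poly_altdef
proof (rule ord_sum_ge)
  fix i assume "i \<in> {..degree p}"
  then have "real i * \<rho> \<ge> real d * \<rho>" using assms(3,4) by (intro mult_right_mono_neg) auto
  then have "ereal (m + real d * \<rho>) \<le> ereal (m + real i * \<rho>)" by simp
  also have "\<dots> \<le> ord (coeff p i * x ^ i)"
    by (intro ord_mult_ge ord_power_ge assms)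
  finally show "ereal (m + real d * \<rho>) \<le> ord (coeff p i * x ^ i)" .
qed

lemma ord_coeff_bounded_below:
  fixes p :: "'a poly"
  obtains m where "\<And>i. ereal m \<le> ord (coeff p i)"
proof -
  have "\<exists>m. \<forall>i. ereal m \<le> ord (coeff p i)"
  proof (induction p)
    case (pCons a p)
    then obtain m where m: "\<And>i. ereal m \<le> ord (coeff p i)" by auto
    have "\<exists>s. ereal s \<le> ord a" by (cases "ord a") auto
    then obtain s where s: "ereal s \<le> ord a" by blast
    have "ereal (min m s) \<le> ord (coeff (pCons a p) i)" for i
    proof (cases i)
      case 0
      then show ?thesis using order.trans[OF _ s, of "ereal (min m s)"] by simp
    next
      case (Suc j)
      show ?thesis unfolding Suc coeff_pCons_Suc by (rule order.trans[OF _ m[of j]]) simp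
    qed
    then show ?case by blast
  qed auto
  with that show thesis by blast
qed

text \<open>The conclusion says that the Newton polygon lies above the line of slope \<open>- \<rho>\<close> through the
  point of the constant coefficient.\<close>

lemma coeff_gt_if_roots_small:
  assumes "\<And>q. q dvd p \<Longrightarrow> degree q > 0 \<Longrightarrow> \<exists>x. poly q x = 0"
    and "\<And>x. poly p x = 0 \<Longrightarrow> ord x < ereal \<rho>"
    and "ord (coeff p 0) = ereal s" and "i > 0"
  shows "ereal (s - real i * \<rho>) < ord (coeff p i)"
  using assms
proof (induction "degree p" arbitrary: p s i)
  case 0
  then have "coeff p i = 0" by (intro coeff_eq_0) auto
  then show ?case by simp
next
  case (Suc d)
  then have "\<exists>x. poly p x = 0" by (metis dvd_refl zero_less_Suc)
  then obtain r where r: "poly p r = 0" by blast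
  then obtain q where q: "p = [:-r, 1:] * q" by (auto simp: poly_eq_0_iff_dvd elim: dvdE)
  with Suc have "q \<noteq> 0" by auto
  then have "degree p = Suc (degree q)" unfolding q by (subst degree_mult_eq) auto
  with Suc have dq: "d = degree q" by simp
  have p0: "coeff p 0 = - (r * coeff q 0)" and pS: "coeff p (Suc j) = coeff q j - r * coeff q (Suc j)" for j
    unfolding q by (auto simp: coeff_pCons)
  have "coeff p 0 \<noteq> 0" using Suc.prems(3) by auto
  then have "r \<noteq> 0" "coeff q 0 \<noteq> 0" using p0 by auto
  then obtain a b where a: "ord r = ereal a" and b: "ord (coeff q 0) = ereal b"
    by (meson ord_finite)
  have s: "s = a + b" using Suc.prems(3) unfolding p0 by (simp add: ord_mult a b)
  have ar: "a < \<rho>" using Suc.prems(2)[OF r] a by simp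
  have IH: "ereal (b - real j * \<rho>) < ord (coeff q j)" if "j > 0" for j
  proof (rule Suc.hyps(1)[OF dq _ _ b that])
    show "\<exists>x. poly u x = 0" if "u dvd q" "degree u > 0" for u
      using Suc.prems(1) that unfolding q by (metis dvd_mult)
    show "ord x < ereal \<rho>" if "poly q x = 0" for x
      using Suc.prems(2)[of x] that unfolding q by simp
  qed
  obtain j where j: "i = Suc j" using Suc.prems(4) by (cases i) auto
  \<comment> \<open>Passing from \<open>p\<close> to \<open>q\<close> lowers \<open>s\<close> by
    \<open>a\<close> and the index by one; because \<open>a < \<rho>\<close>, the line for
    \<open>q\<close> at \<open>j\<close> lies above the line for \<open>p\<close> at
    \<open>Suc j\<close>.\<close>
  have "ereal (s - real i * \<rho>) < ord (coeff q j)"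
  proof (cases "j = 0")
    case True
    then show ?thesis using b s ar j by simp
  next
    case False
    then show ?thesis 
      using IH[of j] s ar j by (intro order_less_trans[OF _ IH[of j]]) (auto simp: algebra_simps)
  qed
  moreover have "ereal (s - real i * \<rho>) < ord (r * coeff q (Suc j))"
    using IH[of "Suc j"] s j a unfolding ord_mult by (cases "ord (coeff q (Suc j))") (auto simp: algebra_simps)
  ultimately show ?case unfolding j pS by (rule ord_diff_gt)
qed

text \<open>Contrapositive of \<open>coeff_gt_if_roots_small\<close>: a single coefficient on or
  below the line forces a root of large valuation. Roots are required only for divisors of
  \<open>p\<close>, because \<open>exists_root\<close> applies this before all polynomials are known
  to have roots.\<close>

lemma exists_root_of_large_ord:
  assumes "\<And>q. q dvd p \<Longrightarrow> degree q > 0 \<Longrightarrow> \<exists>x. poly q x = 0"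
    and "i > 0" and "ord (coeff p i) \<le> ereal c" and "ereal (c + real i * \<rho>) \<le> ord (coeff p 0)"
  obtains x where "poly p x = 0" "ereal \<rho> \<le> ord x"
proof (cases "coeff p 0 = 0")
  case True
  then show ?thesis using that[of 0] by (simp add: poly_0_coeff_0)
next
  case False
  then obtain s where s: "ord (coeff p 0) = ereal s" by (rule ord_finite)
  show ?thesis
  proof (rule ccontr)
    assume "\<not> thesis"
    with that have "ord x < ereal \<rho>" if "poly p x = 0" for x using that by (meson not_le)
    from coeff_gt_if_roots_small[OF assms(1) this s assms(2)]
    have "ereal (s - real i * \<rho>) < ord (coeff p i)" .
    then have "ereal (s - real i * \<rho>) < ereal c" using assms(3) by (rule order_less_le_trans)
    with assms(4) s show False by simp
  qed
qed

text \<open>For a too negative valuation of \<open>x\<close> the leading term would dominate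
  strictly. The bound depends only on \<open>l\<close> and \<open>m\<close>, hence is uniform over
  the approximating polynomials in \<open>exists_root\<close>.\<close>

lemma ord_root_ge:
  assumes "poly p x = 0" "ord (lead_coeff p) = ereal l" "degree p > 0"
    and "\<And>i. ereal m \<le> ord (coeff p i)"
  shows "ereal (min 0 (m - l)) \<le> ord x"
proof (rule ccontr)
  assume neg: "\<not> ?thesis"
  then obtain \<rho> where \<rho>: "ord x = ereal \<rho>" by (cases "ord x") auto
  from neg have \<rho>': "\<rho> < 0" "\<rho> < m - l" unfolding \<rho> by (auto simp del: ereal_min)
  let ?f = "\<lambda>i. coeff p i * x ^ i"
  have ord_lead: "ord (?f (degree p)) = ereal (l + real (degree p) * \<rho>)"
    by (simp add: ord_mult assms(2) ord_power[OF \<rho>])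
  have "?f (degree p) \<noteq> 0" using ord_lead by (metis ord_0 PInfty_neq_ereal(1))
  moreover have "sum ?f {..degree p} = 0" using assms(1) by (simp add: poly_altdef)
  ultimately obtain j where j: "j \<le> degree p" "j \<noteq> degree p" "ord (?f j) \<le> ord (?f (degree p))"
    using ord_dominant_term[of "{..degree p}" "degree p" ?f] by auto
  have "ereal (m + real j * \<rho>) \<le> ord (?f j)"
    by (intro ord_mult_ge assms ord_power_ge) (simp add: \<rho>)
  with j(3) ord_lead have "m + real j * \<rho> \<le> l + real (degree p) * \<rho>"
    by (metis ereal_less_eq(3) order_trans)
  then have "m - l \<le> (real (degree p) - real j) * \<rho>" by (simp add: algebra_simps)
  also have "\<dots> \<le> 1 * \<rho>" using j(1,2) \<rho>'(1) by (intro mult_right_mono_neg) auto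
  finally show False using \<rho>' by simp
qed

section \<open>Limits, and roots in a complete field\<close>

lemma convergent_if_ord_steps:
  assumes "val_complete ord" "d > 0"
    and "\<And>k. ereal (real k / d + C) \<le> ord (X (Suc k) - X k)"
  obtains x where "(\<lambda>n. ord (X n - x)) \<longlonglongrightarrow> \<infinity>"
proof -
  have step: "ereal (real N / d + C) \<le> ord (X (N + j) - X N)" for N j
  proof (induction j)
    case (Suc j)
    have "real N / d + C \<le> real (N + j) / d + C" using \<open>d > 0\<close> by (simp add: divide_right_mono)
    then have "ereal (real N / d + C) \<le> ereal (real (N + j) / d + C)" by simp
    also have "\<dots> \<le> ord (X (Suc (N + j)) - X (N + j))" by (rule assms(3))
    finally have "ereal (real N / d + C) \<le> ord ((X (Suc (N + j)) - X (N + j)) + (X (N + j) - X N))"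
      using Suc by (rule ord_add_ge)
    then show ?case by simp
  qed simp
  have "\<exists>N. \<forall>m\<ge>N. \<forall>n\<ge>N. ord (X m - X n) > ereal r" for r
  proof -
    obtain N :: nat where "real N > (r - C) * d" using reals_Archimedean2 by blast
    then have N: "r < real N / d + C" using \<open>d > 0\<close> by (simp add: field_simps)
    have "ereal r < ord (X m - X n)" if "m \<ge> N" "n \<ge> N" for m n
    proof -
      have "ereal (real N / d + C) \<le> ord ((X m - X N) - (X n - X N))"
        by (rule ord_diff_ge) (use step[of N "m - N"] step[of N "n - N"] that in auto)
      then show ?thesis using N by (auto intro: order_less_le_trans[of _ "ereal (real N / d + C)"])
    qed
    then show ?thesis by blast
  qed
  with assms(1) that show thesis unfolding val_complete_def by meson
qed

text \<open>Expansion around \<open>x\<close> writes \<open>poly p (x + u)\<close> as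
  \<open>poly p x + u * poly q u\<close>; for \<open>u = X k - x\<close> both \<open>u\<close> and
  the value at \<open>X k\<close> have arbitrarily large valuation.\<close>

lemma poly_limit_eq_0:
  assumes "(\<lambda>k. ord (X k - x)) \<longlonglongrightarrow> \<infinity>" "(\<lambda>k. ord (poly p (X k))) \<longlonglongrightarrow> \<infinity>"
  shows "poly p x = 0"
proof (rule ord_eqI_unbounded)
  fix r :: real
  obtain a q where aq: "pcompose p [:x, 1:] = pCons a q" by (metis pCons_cases)
  have pxu: "poly p (x + u) = a + u * poly q u" for u
    using arg_cong[OF aq, of "\<lambda>p. poly p u"] by (simp add: poly_pcompose add.commute)
  then have a: "a = poly p x" by (metis add.right_neutral mult_zero_left)
  obtain m where m: "\<And>i. ereal m \<le> ord (coeff q i)" using ord_coeff_bounded_below by blast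
  have "\<forall>\<^sub>F k in sequentially. ereal (max 0 (r - m)) < ord (X k - x)"
    "\<forall>\<^sub>F k in sequentially. ereal r < ord (poly p (X k))"
    using assms unfolding tendsto_PInfty by blast+
  then have "\<forall>\<^sub>F k in sequentially. ereal (max 0 (r - m)) < ord (X k - x) \<and> ereal r < ord (poly p (X k))"
    by (rule eventually_conj)
  then obtain k where k: "ereal (max 0 (r - m)) < ord (X k - x)" "ereal r < ord (poly p (X k))"
    using eventually_happens'[OF sequentially_bot] by blast
  define u where "u = X k - x"
  have "ereal (m + real (degree q) * 0) \<le> ord (poly q u)"
    using order_trans[OF _ less_imp_le[OF k(1)], of "ereal 0"] m by (intro ord_poly_ge) (auto simp: u_def)
  moreover have "ereal (r - m) \<le> ord u"
    using order_trans[OF _ less_imp_le[OF k(1)], of "ereal (r - m)"] by (auto simp: u_def)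
  ultimately have "ereal (r - m + m) \<le> ord (u * poly q u)" by (intro ord_mult_ge) auto
  then have "ereal r \<le> ord (poly p (X k) - u * poly q u)"
    using k(2) by (intro ord_diff_ge) auto
  also have "poly p (X k) - u * poly q u = poly p x"
    using pxu[of u] a by (simp add: u_def)
  finally show "ereal r \<le> ord (poly p x)" .
qed

text \<open>Polynomials over \<open>K\<close> approximating \<open>p\<close> have roots that form a Cauchy sequence.\<close>

lemma exists_root:
  fixes p :: "'a poly"
  assumes complete: "val_complete ord" and dense: "val_closure ord K = UNIV"
    and closed: "alg_closed_subfield K" and "degree p > 0"
  shows "\<exists>x. poly p x = 0"
  using \<open>degree p > 0\<close>
proof (induction "degree p" arbitrary: p rule: less_induct)
  case less
  define d where "d = degree p"
  have "d > 0" "p \<noteq> 0" using less.prems by (auto simp: d_def)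
  obtain l where l: "ord (coeff p d) = ereal l" using ord_finite[of "lead_coeff p"] \<open>p \<noteq> 0\<close> 
    by (auto simp: d_def)
  obtain m where m: "\<And>i. ereal m \<le> ord (coeff p i)" using ord_coeff_bounded_below by blast
  have "m \<le> l" using m[of d] l by simp
  \<comment> \<open>Precision beyond \<open>l\<close> at every stage preserves the valuation of the
    leading coefficient, hence the degree \<open>d\<close> of the approximations.\<close>
  define e where "e k = max (real k) l" for k
  have "\<exists>s\<in>K. ereal (e k) < ord (coeff p i - s)" for k i
    using dense unfolding val_closure_def by blast
  then obtain s where s: "\<And>k i. s k i \<in> K" "\<And>k i. ereal (e k) < ord (coeff p i - s k i)"
    by metis
  define P where "P k = (\<Sum>i\<le>d. monom (s k i) i)" for k
  have coeff_P: "coeff (P k) i = (if i \<le> d then s k i else 0)" for k i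
    by (auto simp: P_def coeff_sum if_distrib[of "\<lambda>x. coeff x i"] coeff_monom)
  have diff: "ereal (e k) < ord (coeff p i - coeff (P k) i)" for k i
    using s(2)[of k i] by (auto simp: coeff_P d_def coeff_eq_0)
  have lead: "ord (coeff (P k) d) = ereal l" for k
  proof (rule antisym)
    have "ereal l < ord (coeff p d - coeff (P k) d)"
      using diff[of k d] by (auto simp: e_def intro: order_le_less_trans[of _ "ereal (max (real k) l)"] simp del: ereal_max)
    then show "ereal l \<le> ord (coeff (P k) d)"
      using ord_diff_ge[of "ereal l" "coeff p d" "coeff p d - coeff (P k) d"] l by simp
    show "ord (coeff (P k) d) \<le> ereal l"
    proof (rule ccontr)
      assume "\<not> ?thesis"
      then have "ereal l < ord (coeff p d - coeff (P k) d + coeff (P k) d)"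
        using \<open>ereal l < ord (coeff p d - coeff (P k) d)\<close> by (intro ord_add_gt) auto
      then show False using l by simp
    qed
  qed
  have degree_P: "degree (P k) = d" for k
  proof (rule antisym)
    show "degree (P k) \<le> d" by (rule degree_le) (simp add: coeff_P)
    show "d \<le> degree (P k)" by (rule le_degree) (use lead[of k] in auto)
  qed
  have bound_P: "ereal m \<le> ord (coeff (P k) i)" for k i
  proof -
    have "ereal m \<le> ereal (e k)" using \<open>m \<le> l\<close> by (simp add: e_def del: ereal_max)
    also note less_imp_le[OF diff[of k i]]
    finally show ?thesis using ord_diff_ge[OF m[of i], of "coeff p i - coeff (P k) i"] by simp
  qed
  have "set (coeffs (P k)) \<subseteq> K" for k
    using s(1) by (auto simp: coeffs_def coeff_P degree_P less_Suc_eq_le split: if_splits)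
  then have root_P: "\<exists>x. poly (P k) x = 0" for k
    using closed \<open>d > 0\<close> degree_P unfolding alg_closed_subfield_def by metis
  define \<rho> where "\<rho> = min 0 (m - l)"
  have root_bound: "ereal \<rho> \<le> ord x" if "poly (P k) x = 0" for k x
    unfolding \<rho>_def using that lead[of k] \<open>d > 0\<close> bound_P by (intro ord_root_ge[of "P k"]) (auto simp: degree_P)
  have diff_ge: "ereal (real k + real d * \<rho>) \<le> ord (poly q x)" 
    if "\<And>i. ereal (real k) \<le> ord (coeff q i)" "ereal \<rho> \<le> ord x" "degree q \<le> d" for q x k
    using that by (intro ord_poly_ge) (auto simp: \<rho>_def)
  have diff_k: "ereal (real k) \<le> ord (coeff p i - coeff (P j) i)" if "k \<le> j" for i j k
    using that by (intro order_trans[OF _ less_imp_le[OF diff[of j i]]]) (auto simp: e_def simp del: ereal_max)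
  \<comment> \<open>Since \<open>P (Suc k)\<close> is close to \<open>P k\<close>, its value at
    \<open>x\<close> is small. Its translate \<open>Q\<close> by \<open>x\<close> then has a small
    constant coefficient and, compared with the leading one, a root near 0.\<close>
  have step: "\<exists>y. poly (P (Suc k)) y = 0 \<and> ereal (real k / real d + (\<rho> - l / real d)) \<le> ord (y - x)"
    if x: "poly (P k) x = 0" for k x
  proof -
    have "ereal (real k + real d * \<rho>) \<le> ord (poly (P (Suc k) - P k) x)"
    proof (rule diff_ge)
      fix i
      have "ereal (real k) \<le> ord ((coeff p i - coeff (P k) i) - (coeff p i - coeff (P (Suc k)) i))"
        by (intro ord_diff_ge[of _ "coeff p i - coeff (P k) i"] diff_k) auto
      then show "ereal (real k) \<le> ord (coeff (P (Suc k) - P k) i)" by simp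
    qed (use root_bound[OF x] in \<open>auto intro: degree_diff_le simp: degree_P\<close>)
    then have val: "ereal (real k + real d * \<rho>) \<le> ord (poly (P (Suc k)) x)" using x by simp
    define Q where "Q = pcompose (P (Suc k)) [:x, 1:]"
    have dQ: "degree Q = d" by (simp add: Q_def degree_P degree_pcompose)
    have lQ: "coeff Q d = coeff (P (Suc k)) d"
      using lead_coeff_comp[of "[:x, 1:]" "P (Suc k)"] dQ by (simp add: Q_def degree_P)
    have Q0: "coeff Q 0 = poly (P (Suc k)) x"
      by (simp add: Q_def)
    \<comment> \<open>Divisors of smaller degree have roots by induction; one of full degree is a
      scalar multiple of \<open>Q\<close>, whose root comes from the closedness of
      \<open>K\<close>.\<close>
    have split: "\<exists>y. poly q y = 0" if q: "q dvd Q" "degree q > 0" for q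
    proof (cases "degree q < d")
      case True
      then show ?thesis using less.hyps q(2) by (simp add: d_def)
    next
      case False
      from q(1) obtain u where u: "Q = q * u" by (elim dvdE)
      have "u \<noteq> 0" "q \<noteq> 0" using u dQ \<open>d > 0\<close> by auto
      then have "degree u = 0" using u dQ False by (simp add: degree_mult_eq)
      then obtain c where c: "u = [:c:]" by (elim degree_eq_zeroE)
      obtain z where "poly (P (Suc k)) z = 0" using root_P by blast
      then have "poly Q (z - x) = 0" by (simp add: Q_def poly_pcompose)
      then show ?thesis using u c \<open>u \<noteq> 0\<close> by auto
    qed
    obtain u where u: "poly Q u = 0" "ereal (real k / real d + (\<rho> - l / real d)) \<le> ord u"
    proof (rule exists_root_of_large_ord[of Q d l "real k / real d + (\<rho> - l / real d)"])
      have "l + real d * (real k / real d + (\<rho> - l / real d)) = real k + real d * \<rho>"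
        using \<open>d > 0\<close> by (simp add: distrib_left right_diff_distrib)
      with val show "ereal (l + real d * (real k / real d + (\<rho> - l / real d))) \<le> ord (coeff Q 0)"
        unfolding Q0 by (simp only:)
    qed (use split \<open>d > 0\<close> lead lQ in auto)
    have "poly (P (Suc k)) (x + u) = 0" using u(1) by (simp add: Q_def poly_pcompose add.commute)
    with u(2) show ?thesis by (intro exI[of _ "x + u"]) simp
  qed
  obtain X where X: "\<And>k. poly (P k) (X k) = 0"
    "\<And>k. ereal (real k / real d + (\<rho> - l / real d)) \<le> ord (X (Suc k) - X k)"
    using dependent_nat_choice[of "\<lambda>k x. poly (P k) x = 0" 
        "\<lambda>k x y. ereal (real k / real d + (\<rho> - l / real d)) \<le> ord (y - x)"] root_P step by blast
  obtain x where lim: "(\<lambda>n. ord (X n - x)) \<longlonglongrightarrow> \<infinity>"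
    using convergent_if_ord_steps[OF complete _ X(2)] \<open>d > 0\<close> by auto
  have small: "ereal (real k + real d * \<rho>) \<le> ord (poly p (X k))" for k
  proof -
    have "ereal (real k + real d * \<rho>) \<le> ord (poly (p - P k) (X k))"
      using diff_k[of k k] root_bound[OF X(1)]
      by (intro diff_ge) (auto intro!: degree_diff_le simp: degree_P d_def)
    then show ?thesis using X(1) by simp
  qed
  have "(\<lambda>k. ord (poly p (X k))) \<longlonglongrightarrow> \<infinity>"
    unfolding tendsto_PInfty
  proof
    fix r :: real
    obtain N :: nat where N: "r - real d * \<rho> < real N" using reals_Archimedean2 by blast
    have "ereal r < ord (poly p (X k))" if "k \<ge> N" for k
      using N that by (intro order_less_le_trans[OF _ small[of k]]) auto
    then show "\<forall>\<^sub>F k in sequentially. ereal r < ord (poly p (X k))"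
      by (rule eventually_sequentiallyI)
  qed
  with lim show ?case by (intro exI[of _ x] poly_limit_eq_0)
qed

end

text \<open>Each root splits off a linear factor, and the nonvanishing derivative says that the
  cofactor does not vanish there again.\<close>

lemma card_roots_eq_degree:
  fixes p :: "'a::field poly"
  assumes "\<And>q :: 'a poly. degree q > 0 \<Longrightarrow> \<exists>x. poly q x = 0"
    and "p \<noteq> 0" "\<And>x. poly p x = 0 \<Longrightarrow> poly (pderiv p) x \<noteq> 0"
  shows "card {x. poly p x = 0} = degree p"
  using assms(2,3)
proof (induction "degree p" arbitrary: p)
  case 0
  then obtain c where "p = [:c:]" "c \<noteq> 0" by (metis degree_eq_zeroE pCons_0_0)
  then show ?case by simp
next
  case (Suc d)
  then obtain r where r: "poly p r = 0" using assms(1)[of p] by auto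
  then obtain q where q: "p = [:-r, 1:] * q" by (auto simp: poly_eq_0_iff_dvd elim: dvdE)
  with Suc have "q \<noteq> 0" by auto
  then have dp: "degree p = Suc (degree q)" unfolding q by (subst degree_mult_eq) auto
  have p_eq: "poly p x = (x - r) * poly q x" for x
    unfolding q by (simp add: algebra_simps)
  have deriv: "poly (pderiv p) x = (x - r) * poly (pderiv q) x + poly q x" for x
    unfolding q pderiv_mult by (simp add: pderiv_pCons algebra_simps)
  have "poly q r \<noteq> 0" using Suc.prems(2)[OF r] deriv[of r] by auto
  have "card {x. poly q x = 0} = degree q"
  proof (rule Suc.hyps(1))
    show "d = degree q" using Suc.hyps(2) dp by simp
    show "poly (pderiv q) x \<noteq> 0" if "poly q x = 0" for x
      using Suc.prems(2)[of x] deriv[of x] that by (auto simp: p_eq)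
  qed (rule \<open>q \<noteq> 0\<close>)
  moreover have "{x. poly p x = 0} = insert r {x. poly q x = 0}" by (auto simp: p_eq)
  moreover have "finite {x. poly q x = 0}" using \<open>q \<noteq> 0\<close> by (rule poly_roots_finite)
  ultimately show ?case using \<open>poly q r \<noteq> 0\<close> dp by simp
qed

section \<open>Tensor products with free modules\<close>

text \<open>The additive extension of \<open>f\<close> to the free abelian group. Integer
  multiplicities act through \<open>of_int\<close>, hence the values in a ring.\<close>

definition frag_eval :: "('b \<Rightarrow> 'v::ring_1) \<Rightarrow> ('b \<Rightarrow>\<^sub>0 int) \<Rightarrow> 'v" where
  "frag_eval f a = (\<Sum>p\<in>Poly_Mapping.keys a. of_int (Poly_Mapping.lookup a p) * f p)"

lemma frag_eval_superset:
  assumes "finite S" "Poly_Mapping.keys a \<subseteq> S"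
  shows "frag_eval f a = (\<Sum>p\<in>S. of_int (Poly_Mapping.lookup a p) * f p)"
  unfolding frag_eval_def
  by (rule sum.mono_neutral_left) (use assms in \<open>auto simp: in_keys_iff\<close>)

lemma frag_eval_0 [simp]: "frag_eval f 0 = 0"
  by (simp add: frag_eval_def)

lemma frag_eval_of [simp]: "frag_eval f (frag_of p) = f p"
  by (simp add: frag_eval_def)

lemma frag_eval_diff: "frag_eval f (a - b) = frag_eval f a - frag_eval f b"
proof -
  let ?S = "Poly_Mapping.keys a \<union> Poly_Mapping.keys b"
  have "frag_eval f (a - b) = (\<Sum>p\<in>?S. of_int (Poly_Mapping.lookup (a - b) p) * f p)"
    using keys_diff[of a b] by (intro frag_eval_superset) auto
  also have "\<dots> = (\<Sum>p\<in>?S. of_int (Poly_Mapping.lookup a p) * f p) - (\<Sum>p\<in>?S. of_int (Poly_Mapping.lookup b p) * f p)"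
    by (simp add: lookup_minus sum_subtractf left_diff_distrib)
  also have "\<dots> = frag_eval f a - frag_eval f b"
    using frag_eval_superset[of ?S a f] frag_eval_superset[of ?S b f] by simp
  finally show ?thesis .
qed

lemma frag_eval_minus: "frag_eval f (- a) = - frag_eval f a"
  using frag_eval_diff[of f 0 a] by simp

lemma frag_eval_add: "frag_eval f (a + b) = frag_eval f a + frag_eval f b"
  using frag_eval_diff[of f a "- b"] by (simp add: frag_eval_minus)

text \<open>Since \<open>\<phi>\<close> detects the coordinates \<open>c i\<close> of \<open>\<Sum>i. e i \<otimes> c i\<close>, the elements of the tensor
  product are the nonempty fibres of the extension of \<open>\<phi>\<close> to the free abelian group.\<close>

locale free_tensor =
  fixes actM :: "'r \<Rightarrow> 'm::ab_group_add \<Rightarrow> 'm" and actN :: "'r \<Rightarrow> 'n::ab_group_add \<Rightarrow> 'n"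
    and N :: "'n set" and \<phi> :: "'m \<Rightarrow> 'n \<Rightarrow> 'v::ring_1" and I :: "'i set" and e :: "'i \<Rightarrow> 'm"
  assumes finite_I: "finite I"
    and N_0: "0 \<in> N" and N_add: "n \<in> N \<Longrightarrow> n' \<in> N \<Longrightarrow> n + n' \<in> N"
    and N_minus: "n \<in> N \<Longrightarrow> - n \<in> N" and N_act: "n \<in> N \<Longrightarrow> actN r n \<in> N"
    and \<phi>_add_left: "\<phi> (m + m') n = \<phi> m n + \<phi> m' n"
    and \<phi>_add_right: "\<phi> m (n + n') = \<phi> m n + \<phi> m n'"
    and \<phi>_balanced: "\<phi> (actM r m) n = \<phi> m (actN r n)"
    and generated: "\<exists>r. m = (\<Sum>i\<in>I. actM (r i) (e i))"
    and coordinates: "(\<And>i. i \<in> I \<Longrightarrow> c i \<in> N) \<Longrightarrow> (\<Sum>i\<in>I. \<phi> (e i) (c i)) = 0 \<Longrightarrow> i \<in> I \<Longrightarrow> c i = 0"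
begin

abbreviation "F \<equiv> free_Abelian_group (UNIV \<times> N)"

abbreviation "null \<equiv> tensor_null actM actN N"

definition eval :: "(('m \<times> 'n) \<Rightarrow>\<^sub>0 int) \<Rightarrow> 'v" where
  "eval = frag_eval (\<lambda>(m, n). \<phi> m n)"

definition fibre :: "'v \<Rightarrow> (('m \<times> 'n) \<Rightarrow>\<^sub>0 int) set" where
  "fibre u = {a \<in> carrier F. eval a = u}"

definition elements :: "'v set" where
  "elements = {\<Sum>i\<in>I. \<phi> (e i) (c i) | c. \<forall>i\<in>I. c i \<in> N}"

lemma eval_simps [simp]:
  "eval 0 = 0" "eval (frag_of (m, n)) = \<phi> m n" "eval (a + b) = eval a + eval b"
  "eval (a - b) = eval a - eval b" "eval (- a) = - eval a"
  by (simp_all add: eval_def frag_eval_add frag_eval_diff frag_eval_minus)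

lemma eval_sum: "eval (sum f A) = (\<Sum>i\<in>A. eval (f i))"
  by (induction A rule: infinite_finite_induct) auto

lemma relations_subset: "tensor_relations actM actN N \<subseteq> carrier F"
proof
  fix x assume "x \<in> tensor_relations actM actN N"
  then show "x \<in> carrier F"
    unfolding tensor_relations_def
    by (auto dest!: subsetD[OF keys_diff] simp: N_add N_act)
qed

lemma subgroup_null: "subgroup null F"
  unfolding tensor_null_def using relations_subset by (intro group.generate_is_subgroup) auto

lemma null_closed:
  "0 \<in> null" "a \<in> null \<Longrightarrow> b \<in> null \<Longrightarrow> a + b \<in> null" "a \<in> null \<Longrightarrow> - a \<in> null"
  "a \<in> null \<Longrightarrow> b \<in> null \<Longrightarrow> a - b \<in> null" "a \<in> null \<Longrightarrow> Poly_Mapping.keys a \<subseteq> UNIV \<times> N"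
proof -
  show 0: "0 \<in> null" using subgroup.one_closed[OF subgroup_null] by simp
  show add: "a + b \<in> null" if "a \<in> null" "b \<in> null" for a b
    using subgroup.m_closed[OF subgroup_null that] by simp
  show carrier: "Poly_Mapping.keys a \<subseteq> UNIV \<times> N" if "a \<in> null" for a
    using subgroup.mem_carrier[OF subgroup_null that] by simp
  show minus: "- a \<in> null" if "a \<in> null" for a
    using subgroup.m_inv_closed[OF subgroup_null that] carrier[OF that] by simp
  show "a - b \<in> null" if "a \<in> null" "b \<in> null" for a b
    using add[OF that(1) minus[OF that(2)]] by simp
qed

lemma relation_in_null: "a \<in> tensor_relations actM actN N \<Longrightarrow> a \<in> null"
  unfolding tensor_null_def by (rule generate.incl)

lemma null_add_left: "n \<in> N \<Longrightarrow> frag_of (m + m', n) - frag_of (m, n) - frag_of (m', n) \<in> null"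
  by (rule relation_in_null) (auto simp: tensor_relations_def)

lemma null_add_right:
  "n \<in> N \<Longrightarrow> n' \<in> N \<Longrightarrow> frag_of (m, n + n') - frag_of (m, n) - frag_of (m, n') \<in> null"
  by (rule relation_in_null) (auto simp: tensor_relations_def)

lemma null_balanced: "n \<in> N \<Longrightarrow> frag_of (actM r m, n) - frag_of (m, actN r n) \<in> null"
  by (rule relation_in_null) (auto simp: tensor_relations_def)

lemma null_zero_left: "n \<in> N \<Longrightarrow> frag_of (0, n) \<in> null"
  using null_closed(3)[OF null_add_left[of n 0 0]] by simp

lemma null_zero_right: "frag_of (m, 0) \<in> null"
  using null_closed(3)[OF null_add_right[of 0 0 m]] N_0 by simp

lemma null_sum: "(\<And>i. i \<in> A \<Longrightarrow> f i \<in> null) \<Longrightarrow> sum f A \<in> null"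
  by (induction A rule: infinite_finite_induct) (auto intro: null_closed)

lemma null_sum_left:
  assumes "n \<in> N" "finite A"
  shows "frag_of (sum f A, n) - (\<Sum>i\<in>A. frag_of (f i, n)) \<in> null"
  using assms(2)
proof (induction A)
  case empty
  then show ?case using null_zero_left[OF assms(1)] by simp
next
  case (insert x A)
  have "(frag_of (f x + sum f A, n) - frag_of (f x, n) - frag_of (sum f A, n))
      + (frag_of (sum f A, n) - (\<Sum>i\<in>A. frag_of (f i, n))) \<in> null"
    using insert.IH null_add_left[OF assms(1)] by (rule null_closed(2)[rotated])
  then show ?case using insert.hyps by (simp add: algebra_simps)
qed

lemma eval_null: "a \<in> null \<Longrightarrow> eval a = 0"
  unfolding tensor_null_def
proof (induction rule: generate.induct)
  case one
  then show ?case by simp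
next
  case (incl h)
  then show ?case by (auto simp: tensor_relations_def \<phi>_add_left \<phi>_add_right \<phi>_balanced)
next
  case (inv h)
  then have "h \<in> carrier F" using relations_subset by blast
  with inv show ?case by (auto simp: tensor_relations_def \<phi>_add_left \<phi>_add_right \<phi>_balanced)
qed auto

text \<open>A generator \<open>(m, n)\<close> is rewritten by expanding \<open>m\<close> over the
  \<open>e i\<close> and moving each scalar to the right factor. Differences of normal forms are
  again normal forms, by additivity on the right.\<close>

lemma normal_form:
  assumes "a \<in> carrier F"
  obtains c where "\<And>i. i \<in> I \<Longrightarrow> c i \<in> N" "a - (\<Sum>i\<in>I. frag_of (e i, c i)) \<in> null"
proof -
  have "Poly_Mapping.keys a \<subseteq> UNIV \<times> N" using assms by simp
  then have "\<exists>c. (\<forall>i\<in>I. c i \<in> N) \<and> a - (\<Sum>i\<in>I. frag_of (e i, c i)) \<in> null"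
  proof (induction a rule: free_Abelian_group_induct[consumes 1, case_names zero diff single])
    case zero
    have "0 - (\<Sum>i\<in>I. frag_of (e i, 0)) \<in> null"
      by (intro null_closed null_sum null_zero_right)
    with N_0 show ?case by (intro exI[of _ "\<lambda>_. 0"]) simp
  next
    case (diff x y)
    then obtain c d where c: "\<forall>i\<in>I. c i \<in> N" "x - (\<Sum>i\<in>I. frag_of (e i, c i)) \<in> null"
      and d: "\<forall>i\<in>I. d i \<in> N" "y - (\<Sum>i\<in>I. frag_of (e i, d i)) \<in> null" by blast
    have cd: "\<forall>i\<in>I. c i - d i \<in> N" using c d N_add[OF _ N_minus] by fastforce
    have "(x - (\<Sum>i\<in>I. frag_of (e i, c i))) - (y - (\<Sum>i\<in>I. frag_of (e i, d i)))
       + (\<Sum>i\<in>I. frag_of (e i, (c i - d i) + d i) - frag_of (e i, c i - d i) - frag_of (e i, d i)) \<in> null"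
      by (rule null_closed(2)[OF null_closed(4)[OF c(2) d(2)] null_sum[OF null_add_right]])
        (use c d cd in auto)
    then have "x - y - (\<Sum>i\<in>I. frag_of (e i, c i - d i)) \<in> null"
      by (simp add: sum_subtractf sum.distrib algebra_simps)
    with cd show ?case by (intro exI[of _ "\<lambda>i. c i - d i"]) simp
  next
    case (single p)
    then obtain m n where p: "p = (m, n)" "n \<in> N" by auto
    obtain r where r: "m = (\<Sum>i\<in>I. actM (r i) (e i))" using generated by blast
    have "(frag_of (m, n) - (\<Sum>i\<in>I. frag_of (actM (r i) (e i), n)))
      + (\<Sum>i\<in>I. frag_of (actM (r i) (e i), n) - frag_of (e i, actN (r i) n)) \<in> null"
      unfolding r by (rule null_closed(2)[OF null_sum_left null_sum[OF null_balanced]])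
        (use p(2) finite_I in auto)
    then show ?case using p N_act by (intro exI[of _ "\<lambda>i. actN (r i) n"]) (simp add: sum_subtractf)
  qed
  with that show thesis by blast
qed

text \<open>Relations vanish under \<open>eval\<close> by bilinearity and balancedness. Conversely,
  the normal form of an element of the kernel has zero coordinates, and the generators
  \<open>(e i, 0)\<close> are null.\<close>

lemma null_eq_kernel: "null = {a \<in> carrier F. eval a = 0}"
proof
  show "null \<subseteq> {a \<in> carrier F. eval a = 0}" using eval_null null_closed(5) by auto
  show "{a \<in> carrier F. eval a = 0} \<subseteq> null"
  proof clarify
    fix a assume a: "a \<in> carrier F" "eval a = 0"
    obtain c where c: "\<And>i. i \<in> I \<Longrightarrow> c i \<in> N" "a - (\<Sum>i\<in>I. frag_of (e i, c i)) \<in> null"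
      using normal_form[OF a(1)] by blast
    from eval_null[OF c(2)] a(2) have "(\<Sum>i\<in>I. \<phi> (e i) (c i)) = 0"
      by (simp add: eval_sum)
    with coordinates c(1) have "\<And>i. i \<in> I \<Longrightarrow> c i = 0" by blast
    then have "(\<Sum>i\<in>I. frag_of (e i, c i)) \<in> null" by (intro null_sum) (simp add: null_zero_right)
    from null_closed(2)[OF c(2) this] show "a \<in> null" by simp
  qed
qed

lemma coset_eq_fibre: "a \<in> carrier F \<Longrightarrow> null #>\<^bsub>F\<^esub> a = fibre (eval a)"
proof (intro equalityI subsetI)
  fix x assume a: "a \<in> carrier F" and "x \<in> null #>\<^bsub>F\<^esub> a"
  then obtain b where b: "b \<in> null" "x = b + a" by (auto simp: r_coset_def)
  with a show "x \<in> fibre (eval a)"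
    using null_closed(5)[OF b(1)] eval_null[OF b(1)] keys_add[of b a] by (auto simp: fibre_def)
next
  fix x assume a: "a \<in> carrier F" and "x \<in> fibre (eval a)"
  then have "x - a \<in> null"
    using keys_diff[of x a] by (auto simp: fibre_def null_eq_kernel)
  then show "x \<in> null #>\<^bsub>F\<^esub> a" by (force simp: r_coset_def)
qed

lemma eval_in_elements: "a \<in> carrier F \<Longrightarrow> eval a \<in> elements"
proof -
  assume "a \<in> carrier F"
  then obtain c where c: "\<And>i. i \<in> I \<Longrightarrow> c i \<in> N" "a - (\<Sum>i\<in>I. frag_of (e i, c i)) \<in> null"
    using normal_form by blast
  from eval_null[OF c(2)] have "eval a = (\<Sum>i\<in>I. \<phi> (e i) (c i))" by (simp add: eval_sum)
  with c(1) show ?thesis unfolding elements_def by blast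
qed

lemma fibre_nonempty:
  assumes "u \<in> elements"
  obtains a where "a \<in> carrier F" "eval a = u"
proof -
  from assms obtain c where c: "u = (\<Sum>i\<in>I. \<phi> (e i) (c i))" "\<forall>i\<in>I. c i \<in> N"
    unfolding elements_def by blast
  have "(\<Sum>i\<in>I. frag_of (e i, c i)) \<in> carrier F"
    using c(2) by (intro sum_closed_free_Abelian_group) auto
  with that show thesis by (simp add: eval_sum c(1))
qed

lemma elements_eq_image: "elements = eval ` carrier F"
  using eval_in_elements fibre_nonempty by (blast intro: image_eqI)

lemma carrier_tensor_product: "carrier (tensor_product actM actN N) = fibre ` elements"
proof -
  have "carrier (tensor_product actM actN N) = (\<lambda>a. null #>\<^bsub>F\<^esub> a) ` carrier F"
    unfolding tensor_product_def FactGroup_def RCOSETS_def by (simp add: UNION_singleton_eq_range)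
  also have "\<dots> = (\<lambda>a. fibre (eval a)) ` carrier F"
    by (rule image_cong) (auto simp only: coset_eq_fibre)
  finally show ?thesis by (simp only: elements_eq_image image_image)
qed

lemma inj_on_fibre: "inj_on fibre elements"
proof (rule inj_onI)
  fix u w assume "u \<in> elements" "fibre u = fibre w"
  then show "u = w" using fibre_nonempty[of u] unfolding fibre_def by blast
qed

lemma comm_group_tensor_product: "comm_group (tensor_product actM actN N)"
  unfolding tensor_product_def
  by (intro comm_group.abelian_FactGroup abelian_free_Abelian_group subgroup_null)

lemma one_tensor_product: "\<one>\<^bsub>tensor_product actM actN N\<^esub> = fibre 0"
  unfolding tensor_product_def FactGroup_def fibre_def by (simp add: null_eq_kernel)

lemma mult_tensor_product:
  assumes "u \<in> elements" "w \<in> elements"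
  shows "fibre u \<otimes>\<^bsub>tensor_product actM actN N\<^esub> fibre w = fibre (u + w)"
proof -
  obtain a b where ab: "a \<in> carrier F" "b \<in> carrier F" "eval a = u" "eval b = w"
    using assms fibre_nonempty by metis
  have "normal null F"
    using comm_group.subgroup_imp_normal[OF abelian_free_Abelian_group subgroup_null] .
  then have "(null #>\<^bsub>F\<^esub> a) <#>\<^bsub>F\<^esub> (null #>\<^bsub>F\<^esub> b) = null #>\<^bsub>F\<^esub> (a + b)"
    using normal.rcos_sum[of null F a b] ab by simp
  moreover have "a + b \<in> carrier F" using ab keys_add[of a b] by auto
  ultimately have "fibre u <#>\<^bsub>F\<^esub> fibre w = fibre (u + w)"
    using coset_eq_fibre[OF ab(1)] coset_eq_fibre[OF ab(2)] coset_eq_fibre[of "a + b"] ab(3,4) by simp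
  then show ?thesis by (simp add: tensor_product_def FactGroup_def)
qed

lemma zero_in_elements: "0 \<in> elements"
  using eval_in_elements[of 0] by simp

lemma add_in_elements: "u \<in> elements \<Longrightarrow> w \<in> elements \<Longrightarrow> u + w \<in> elements"
proof -
  assume "u \<in> elements" "w \<in> elements"
  then obtain a b where "a \<in> carrier F" "b \<in> carrier F" "eval a = u" "eval b = w"
    using fibre_nonempty by metis
  then show ?thesis using eval_in_elements[of "a + b"] keys_add[of a b] by auto
qed

lemma sum_in_elements: "(\<And>i. i \<in> A \<Longrightarrow> f i \<in> elements) \<Longrightarrow> sum f A \<in> elements"
  by (induction A rule: infinite_finite_induct) (auto intro: zero_in_elements add_in_elements)

lemma finprod_tensor_product:
  assumes "finite A" "\<And>i. i \<in> A \<Longrightarrow> f i \<in> elements"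
  shows "finprod (tensor_product actM actN N) (\<lambda>i. fibre (f i)) A = fibre (sum f A)"
proof -
  interpret T: comm_group "tensor_product actM actN N" by (rule comm_group_tensor_product)
  show ?thesis using assms
  proof (induction A)
    case empty
    then show ?case by (simp add: one_tensor_product)
  next
    case (insert x A)
    then show ?case
      by (simp add: T.finprod_insert carrier_tensor_product mult_tensor_product sum_in_elements)
  qed
qed

text \<open>\<open>tensor_map\<close> is a union over all representatives of a coset; each of them
  lands in the same fibre, because \<open>s\<close> describes the map on the values of
  \<open>eval\<close>.\<close>

lemma tensor_map_fibre:
  assumes "u \<in> elements" and w: "\<And>n. n \<in> N \<Longrightarrow> w n \<in> N"
    and s_add: "\<And>x y. s (x - y) = s x - s y" and s_\<phi>: "\<And>m n. n \<in> N \<Longrightarrow> \<phi> (h m) (w n) = s (\<phi> m n)"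
  shows "tensor_map actM actN N h w (fibre u) = fibre (s u)"
proof -
  let ?g = "frag_extend (\<lambda>(m, n). frag_of (h m, w n))"
  have g: "?g a \<in> carrier F \<and> eval (?g a) = s (eval a)" if "a \<in> carrier F" for a
  proof -
    have "Poly_Mapping.keys a \<subseteq> UNIV \<times> N" using that by simp
    then show ?thesis
    proof (induction a rule: free_Abelian_group_induct[consumes 1, case_names zero diff single])
      case zero
      then show ?case using s_add[of 0 0] by simp
    next
      case (diff x y)
      then show ?case using keys_diff[of "?g x" "?g y"] by (auto simp: frag_extend_diff s_add)
    qed (auto simp: w s_\<phi>)
  qed
  obtain a where a: "a \<in> carrier F" "eval a = u" using fibre_nonempty[OF assms(1)] .
  have "null #>\<^bsub>F\<^esub> ?g x = fibre (s u)" if "x \<in> fibre u" for x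
    using that g[of x] coset_eq_fibre[of "?g x"] by (auto simp: fibre_def)
  moreover have "a \<in> fibre u" using a by (simp add: fibre_def)
  ultimately show ?thesis unfolding tensor_map_def by blast
qed

end

section \<open>Coordinates on the t-motive\<close>

lemma of_bit_add_char_2:
  assumes "CHAR('a::field) = 2"
  shows "of_bit (b + c) = (of_bit b + of_bit c :: 'a)"
proof -
  have "1 + 1 = (0::'a)" using uminus_CHAR_2[OF assms, of 1] by (metis add.right_inverse)
  then show ?thesis by (cases b; cases c) auto
qed

lemma sum_coeff_bound:
  assumes "\<And>i. g i 0 = 0" "degree p \<le> N"
  shows "(\<Sum>i\<le>degree p. g i (coeff p i)) = (\<Sum>i\<le>N. g i (coeff p i))"
  by (rule sum.mono_neutral_left) (use assms in \<open>auto simp: coeff_eq_0\<close>)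

text \<open>Left modules over twisted polynomials in an \<open>s\<close>-semilinear operator
  \<open>F\<close>. One framework serves \<tau> on the motive and on coordinate vectors, where
  \<open>s\<close> is squaring, and also \<open>T\<close>, where \<open>s\<close> is the
  identity.\<close>

locale twisted_module =
  fixes scale :: "'a::field \<Rightarrow> 'w::ab_group_add \<Rightarrow> 'w" and s :: "'a \<Rightarrow> 'a" and F :: "'w \<Rightarrow> 'w"
  assumes scale_add_left: "scale (c + d) w = scale c w + scale d w"
    and scale_add_right: "scale c (w + w') = scale c w + scale c w'"
    and scale_scale: "scale c (scale d w) = scale (c * d) w"
    and scale_one [simp]: "scale 1 w = w"
    and s_0: "s 0 = 0"
    and F_add: "F (w + w') = F w + F w'"
    and F_scale: "F (scale c w) = scale (s c) (F w)"
begin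

definition act :: "'a poly \<Rightarrow> 'w \<Rightarrow> 'w" where
  "act P w = (\<Sum>i\<le>degree P. scale (coeff P i) ((F ^^ i) w))"

lemma zero_simps [simp]: "scale 0 w = 0" "scale c 0 = 0" "F 0 = 0"
  using scale_add_left[of 0 0 w] scale_add_right[of c 0 0] F_add[of 0 0] by auto

lemma scale_sum: "scale c (sum f A) = (\<Sum>i\<in>A. scale c (f i))"
  by (induction A rule: infinite_finite_induct) (auto simp: scale_add_right)

lemma F_sum: "F (sum f A) = (\<Sum>i\<in>A. F (f i))"
  by (induction A rule: infinite_finite_induct) (auto simp: F_add)

lemma act_bound: "degree P \<le> N \<Longrightarrow> act P w = (\<Sum>i\<le>N. scale (coeff P i) ((F ^^ i) w))"
  unfolding act_def by (rule sum_coeff_bound) auto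

lemma act_0 [simp]: "act 0 w = 0"
  by (simp add: act_def)

lemma act_1 [simp]: "act 1 w = w"
  by (simp add: act_def)

lemma act_add: "act (P + Q) w = act P w + act Q w"
proof -
  let ?N = "max (degree P) (degree Q)"
  have "act (P + Q) w = (\<Sum>i\<le>?N. scale (coeff (P + Q) i) ((F ^^ i) w))"
    by (rule act_bound) (rule degree_add_le_max)
  also have "\<dots> = act P w + act Q w"
    using act_bound[of P ?N w] act_bound[of Q ?N w] by (simp add: scale_add_left sum.distrib)
  finally show ?thesis .
qed

lemma act_smult: "act (smult c P) w = scale c (act P w)"
  using act_bound[of "smult c P" "degree P" w] by (simp add: act_def scale_sum scale_scale degree_smult_le)

lemma act_F: "act (pCons 0 (map_poly s P)) w = F (act P w)"
proof -
  let ?Q = "pCons 0 (map_poly s P)"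
  have "degree (map_poly s P) \<le> degree P" by (rule map_poly_degree_leq)
  then have "degree ?Q \<le> Suc (degree P)" by (auto intro: order_trans[OF degree_pCons_le])
  then have "act ?Q w = (\<Sum>i\<le>Suc (degree P). scale (coeff ?Q i) ((F ^^ i) w))" by (rule act_bound)
  also have "\<dots> = (\<Sum>i\<le>degree P. scale (s (coeff P i)) (F ((F ^^ i) w)))"
    by (subst sum.atMost_Suc_shift) (simp add: coeff_map_poly s_0)
  also have "\<dots> = F (act P w)" by (simp add: act_def F_sum F_scale)
  finally show ?thesis .
qed

end

text \<open>Used for \<tau> against polynomials in \<open>T\<close>, for \<open>coords\<close>
  against \<tau>, and for multiplication by \<open>T\<close> against \<tau> on coordinates. The map
  \<open>u\<close> records the effect on scalars.\<close>

lemma twisted_act_hom: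
  assumes "twisted_module sc s F" "twisted_module sc' s' F'"
    and h_add: "\<And>x y. h (x + y) = h x + h y" and h_scale: "\<And>c x. h (sc c x) = sc' (u c) (h x)"
    and h_F: "\<And>x. h (F x) = F' (h x)" and "u 0 = 0"
  shows "h (twisted_module.act sc F P w) = twisted_module.act sc' F' (map_poly u P) (h w)"
proof -
  interpret A: twisted_module sc s F by fact
  interpret B: twisted_module sc' s' F' by fact
  have h_0: "h 0 = 0" using h_add[of 0 0] by simp
  have h_sum: "h (sum f S) = (\<Sum>i\<in>S. h (f i))" for f and S :: "nat set"
    by (induction S rule: infinite_finite_induct) (auto simp: h_add h_0)
  have h_iter: "h ((F ^^ i) w) = (F' ^^ i) (h w)" for i
    by (induction i) (auto simp: h_F)
  show ?thesis
    unfolding A.act_def B.act_bound[OF map_poly_degree_leq]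
    by (simp add: h_sum h_scale h_iter coeff_map_poly \<open>u 0 = 0\<close>)
qed

definition fps_scale :: "'a::field fps \<Rightarrow> 'a fps ^ 2 ^ 2 \<Rightarrow> 'a fps ^ 2 ^ 2" where
  "fps_scale f z = (\<chi> k j. f * z $ k $ j)"

lemma fps_scale_nth [simp]: "fps_scale f z $ k $ j = f * z $ k $ j"
  by (simp add: fps_scale_def)

lemma fps_scale_simps:
  "fps_scale (f + g) z = fps_scale f z + fps_scale g z"
  "fps_scale f (z + z') = fps_scale f z + fps_scale f z'"
  "fps_scale f (fps_scale g z) = fps_scale (f * g) z"
  "fps_scale 1 z = z"
  by (simp_all add: vec_eq_iff algebra_simps)

lemma fps_scale_sum: "fps_scale f (sum g S) = (\<Sum>i\<in>S. fps_scale f (g i))"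
  by (induction S rule: infinite_finite_induct) (auto simp: fps_scale_simps(2) vec_eq_iff)

text \<open>The matrix of \<open>\<tau>\<close> in the basis \<open>e\<^sub>1, e\<^sub>2, \<tau> e\<^sub>1, \<tau> e\<^sub>2\<close> over the polynomials in \<open>T\<close>: the
  first index of a coordinate is \<open>1\<close> for \<open>e\<^sub>j\<close> and \<open>2\<close> for \<open>\<tau> e\<^sub>j\<close>, the second one is \<open>j\<close>.\<close>

definition tau_coords :: "'a::field \<Rightarrow> 'a ^ 2 ^ 2 \<Rightarrow> 'a fps ^ 2 ^ 2 \<Rightarrow> 'a fps ^ 2 ^ 2" where
  "tau_coords \<theta> A z = (\<chi> k j. if k = 1 then (fps_X - fps_const \<theta>) * tate_tau (z $ 2 $ j)
     else tate_tau (z $ 1 $ j) - (\<Sum>l\<in>UNIV. fps_const (A $ l $ j) * tate_tau (z $ 2 $ l)))"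

definition gen :: "2 \<times> 2 \<Rightarrow> 'a::field motive" where
  "gen i = (if fst i = 1 then motive_basis (snd i) else motive_tau (motive_basis (snd i)))"

lemma neq_one_iff_2: "(k::2) \<noteq> 1 \<longleftrightarrow> k = 2"
  using exhaust_2[of k] by auto

locale motive_char_2 =
  fixes \<theta> :: "'a::field" and A :: "'a ^ 2 ^ 2"
  assumes char_2: "CHAR('a) = 2"
begin

lemma square_add: "(x + y)\<^sup>2 = x\<^sup>2 + (y::'a)\<^sup>2"
  by (rule freshmans_dream) (simp_all add: char_2)

lemma square_sum: "(sum f S)\<^sup>2 = (\<Sum>i\<in>S. (f i)\<^sup>2 :: 'a)"
  by (rule freshmans_dream_sum) (simp_all add: char_2)

lemma tate_tau_add: "tate_tau (f + g) = tate_tau f + tate_tau (g::'a fps)"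
  by (simp add: tate_tau_def fps_eq_iff square_add)

lemma tate_tau_mult: "tate_tau (f * g) = tate_tau f * tate_tau (g::'a fps)"
  by (simp add: tate_tau_def fps_eq_iff fps_mult_nth square_sum power_mult_distrib)

lemma tate_tau_const [simp]: "tate_tau (fps_const c) = fps_const (c\<^sup>2 :: 'a)"
  by (simp add: tate_tau_def fps_eq_iff)

lemma tate_tau_0 [simp]: "tate_tau (0 :: 'a fps) = 0" and tate_tau_1 [simp]: "tate_tau (1 :: 'a fps) = 1"
  and tate_tau_X [simp]: "tate_tau (fps_X :: 'a fps) = fps_X"
  by (simp_all add: tate_tau_def fps_eq_iff fps_X_def)

abbreviation "\<sigma> \<equiv> tau_coords \<theta> A"

lemma \<sigma>_add: "\<sigma> (z + w) = \<sigma> z + \<sigma> w"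
  by (simp add: vec_eq_iff tau_coords_def tate_tau_add sum.distrib algebra_simps)

lemma \<sigma>_scale: "\<sigma> (fps_scale f z) = fps_scale (tate_tau f) (\<sigma> z)"
  by (simp add: vec_eq_iff tau_coords_def tate_tau_mult algebra_simps sum_distrib_left)

lemma motive_scale_simps:
  "motive_scale (c + d) m = motive_scale c m + motive_scale d (m::'a motive)"
  "motive_scale c (m + m') = motive_scale c m + motive_scale c (m'::'a motive)"
  "motive_scale c (motive_scale d m) = motive_scale (c * d) (m::'a motive)"
  "motive_scale 1 m = (m::'a motive)"
  by (simp_all add: motive_scale_def vec_eq_iff smult_add_left smult_add_right)

lemma motive_tau_add: "motive_tau (m + m') = motive_tau m + motive_tau (m'::'a motive)"
  by (simp add: motive_tau_def vec_eq_iff poly_eq_iff coeff_map_poly coeff_pCons square_add split: nat.splits)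

lemma motive_tau_scale: "motive_tau (motive_scale c m) = motive_scale (c\<^sup>2) (motive_tau (m::'a motive))"
  by (simp add: motive_tau_def motive_scale_def vec_eq_iff poly_eq_iff coeff_map_poly coeff_pCons
      power_mult_distrib split: nat.splits)

sublocale M: twisted_module "motive_scale :: 'a \<Rightarrow> 'a motive \<Rightarrow> 'a motive" "\<lambda>c. c\<^sup>2" motive_tau
  by unfold_locales (simp_all add: motive_scale_simps motive_tau_add motive_tau_scale)

sublocale V: twisted_module "\<lambda>c. fps_scale (fps_const c)" "\<lambda>c. c\<^sup>2" \<sigma>
  by unfold_locales
    (simp_all add: fps_scale_simps \<sigma>_add \<sigma>_scale flip: fps_const_add fps_const_mult)

lemma twisted_act_eq: "twisted_act = M.act"
  by (simp add: fun_eq_iff twisted_act_def M.act_def)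

abbreviation "mT \<equiv> motive_T \<theta> A"

lemma mT_add: "mT (m + m') = mT m + mT m'"
  by (simp add: motive_T_def twisted_act_eq M.act_add sum.distrib)

lemma mT_scale: "mT (motive_scale c m) = motive_scale c (mT m)"
  by (simp add: motive_T_def twisted_act_eq M.scale_sum M.act_smult motive_scale_def[of c m])

lemma mT_tau: "mT (motive_tau m) = motive_tau (mT m)"
  by (simp add: motive_T_def twisted_act_eq M.F_sum M.act_F motive_tau_def[of m])

sublocale T: twisted_module motive_scale "\<lambda>c. c" mT
  by unfold_locales (simp_all add: motive_scale_simps mT_add mT_scale)

lemma motive_poly_act_eq: "motive_poly_act \<theta> A = T.act"
  by (simp add: fun_eq_iff motive_poly_act_def T.act_def)

lemma poly_act_T: "T.act (pCons 0 P) m = mT (T.act P m)"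
  using T.act_F[of P m] by (simp only: map_poly_id')

lemma tau_poly_act: "motive_tau (T.act P m) = T.act (map_poly (\<lambda>c. c\<^sup>2) P) (motive_tau m)"
  by (rule twisted_act_hom[OF T.twisted_module_axioms T.twisted_module_axioms])
    (simp_all add: motive_tau_add motive_tau_scale mT_tau)

lemma coeff_twisted_basis:
  "coeff ((motive_tau ^^ i) (motive_basis j) $ l) n = (if l = j \<and> n = i then 1 else 0 :: 'a)"
proof (induction i arbitrary: n)
  case 0
  show ?case by (auto simp: motive_basis_def axis_def)
next
  case (Suc i)
  then show ?case
    by (cases n) (simp_all add: motive_tau_def[of "(motive_tau ^^ i) _"] coeff_map_poly)
qed

lemma motive_expand: "(m::'a motive) = (\<Sum>j\<in>UNIV. M.act (m $ j) (motive_basis j))"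
proof -
  have "coeff (M.act P (motive_basis j) $ l) n = (if l = j then coeff P n else 0 :: 'a)" for P j l n
  proof -
    have "coeff (M.act P (motive_basis j) $ l) n
        = (\<Sum>i\<le>degree P. coeff P i * (if l = j \<and> n = i then 1 else 0))"
      by (simp add: M.act_def coeff_sum motive_scale_def coeff_twisted_basis)
    also have "\<dots> = (if l = j then coeff P n else 0)"
      by (auto simp: if_distrib[of "\<lambda>x. _ * x"] coeff_eq_0 cong: if_cong)
    finally show ?thesis .
  qed
  then show ?thesis by (simp add: vec_eq_iff poly_eq_iff coeff_sum)
qed

lemma mT_basis: "mT (motive_basis j) = motive_T_basis \<theta> A j"
proof -
  have "M.act ((motive_basis j :: 'a motive) $ l) w = (if l = j then w else 0)" for l w
    by (simp add: motive_basis_def axis_def)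
  then show ?thesis by (simp add: motive_T_def twisted_act_eq)
qed

section \<open>Generation of the t-motive by four elements over the polynomials in
  \<open>T\<close>\<close>

definition span :: "'a motive set" where
  "span = range (\<lambda>r. \<Sum>i\<in>UNIV. T.act (r i) (gen i))"

lemma span_add: "m \<in> span \<Longrightarrow> m' \<in> span \<Longrightarrow> m + m' \<in> span"
proof -
  have "(\<Sum>i\<in>UNIV. T.act (r i) (gen i)) + (\<Sum>i\<in>UNIV. T.act (r' i) (gen i)) \<in> span" for r r' :: "2 \<times> 2 \<Rightarrow> 'a poly"
    unfolding span_def by (rule range_eqI[of _ _ "\<lambda>i. r i + r' i"]) (simp add: T.act_add sum.distrib)
  then show "m \<in> span \<Longrightarrow> m' \<in> span \<Longrightarrow> m + m' \<in> span" unfolding span_def by blast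
qed

lemma span_scale: "m \<in> span \<Longrightarrow> motive_scale c m \<in> span"
proof -
  have "motive_scale c (\<Sum>i\<in>UNIV. T.act (r i) (gen i)) \<in> span" for r :: "2 \<times> 2 \<Rightarrow> 'a poly"
    unfolding span_def by (rule range_eqI[of _ _ "\<lambda>i. smult c (r i)"]) (simp add: T.act_smult M.scale_sum)
  then show "m \<in> span \<Longrightarrow> motive_scale c m \<in> span" unfolding span_def by blast
qed

lemma span_T: "m \<in> span \<Longrightarrow> mT m \<in> span"
proof -
  have "mT (\<Sum>i\<in>UNIV. T.act (r i) (gen i)) \<in> span" for r :: "2 \<times> 2 \<Rightarrow> 'a poly"
    unfolding span_def by (rule range_eqI[of _ _ "\<lambda>i. pCons 0 (r i)"]) (simp add: poly_act_T T.F_sum)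
  then show "m \<in> span \<Longrightarrow> mT m \<in> span" unfolding span_def by blast
qed

lemma span_0: "0 \<in> span"
  unfolding span_def by (rule range_eqI[of _ _ "\<lambda>i. 0"]) simp

lemma span_sum: "(\<And>i. i \<in> S \<Longrightarrow> f i \<in> span) \<Longrightarrow> sum f S \<in> span"
  by (induction S rule: infinite_finite_induct) (auto intro: span_add span_0)

lemma span_poly_act: "m \<in> span \<Longrightarrow> T.act P m \<in> span"
proof -
  assume m: "m \<in> span"
  have "(mT ^^ i) m \<in> span" for i by (induction i) (auto intro: m span_T)
  then show ?thesis unfolding T.act_def by (intro span_sum span_scale)
qed

lemma span_gen: "gen i \<in> span"
proof -
  have "T.act (if l = i then 1 else 0) (gen l) = (if l = i then gen l else 0)" for l
    by simp
  then show ?thesis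
    unfolding span_def by (intro range_eqI[of _ _ "\<lambda>l. if l = i then 1 else 0"]) simp
qed

lemma span_tau_gen: "motive_tau (gen i) \<in> span"
proof (cases "fst i = 1")
  case True
  then show ?thesis using span_gen[of "(2, snd i)"] by (simp add: gen_def)
next
  case False
  define j where "j = snd i"
  have b: "motive_basis l \<in> span" "motive_tau (motive_basis l) \<in> span" for l
    using span_gen[of "(1, l)"] span_gen[of "(2, l)"] by (simp_all add: gen_def)
  \<comment> \<open>The defining relation for \<open>T e\<^sub>j\<close> is solved for
    \<open>\<tau>\<^sup>2 e\<^sub>j\<close>.\<close>
  have "motive_tau (gen i) = mT (motive_basis j)
      + motive_scale (-1) (motive_scale \<theta> (motive_basis j)
         + (\<Sum>k\<in>UNIV. motive_scale (A $ j $ k) (motive_tau (motive_basis k))))"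
  proof -
    have minus: "motive_scale (-1) m = - m" for m :: "'a motive"
      by (simp add: motive_scale_def vec_eq_iff)
    show ?thesis using False unfolding minus mT_basis motive_T_basis_def by (simp add: gen_def j_def)
  qed
  also have "\<dots> \<in> span" by (intro span_add span_scale span_sum span_T b)
  finally show ?thesis .
qed

lemma span_tau: "m \<in> span \<Longrightarrow> motive_tau m \<in> span"
proof -
  have "motive_tau (\<Sum>i\<in>UNIV. T.act (r i) (gen i)) \<in> span" for r :: "2 \<times> 2 \<Rightarrow> 'a poly"
    unfolding M.F_sum tau_poly_act by (intro span_sum span_poly_act span_tau_gen)
  then show "m \<in> span \<Longrightarrow> motive_tau m \<in> span" unfolding span_def by blast
qed

text \<open>The elements \<open>\<tau>\<^sup>i e\<^sub>j\<close> span the motive over the scalars,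
  and they are reached from \<open>e\<^sub>j\<close> by stability under \<tau>.\<close>

lemma span_UNIV: "m \<in> span"
proof -
  have "(motive_tau ^^ i) (motive_basis j) \<in> span" for i j
    using span_gen[of "(1, j)"] by (induction i) (auto simp: gen_def intro: span_tau)
  then show ?thesis
    by (subst motive_expand) (auto simp: M.act_def intro!: span_sum span_scale)
qed

text \<open>Defined through freeness over the twisted polynomials in \<tau>, so that compatibility
  with \<tau> is immediate and only that with \<open>T\<close> needs an argument. Power series are
  the target in order to allow multiplication by restricted series.\<close>

definition coords :: "'a motive \<Rightarrow> 'a fps ^ 2 ^ 2" where
  "coords m = (\<Sum>j\<in>UNIV. V.act (m $ j) (axis 1 (axis j 1)))"

lemma coords_add: "coords (m + m') = coords m + coords m'"
  by (simp add: coords_def V.act_add sum.distrib)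

lemma coords_scale: "coords (motive_scale c m) = fps_scale (fps_const c) (coords m)"
  by (simp add: coords_def motive_scale_def V.act_smult V.scale_sum)

lemma coords_tau: "coords (motive_tau m) = \<sigma> (coords m)"
  by (simp add: coords_def motive_tau_def V.act_F V.F_sum)

lemma coords_sum: "coords (sum f S) = (\<Sum>i\<in>S. coords (f i))"
proof -
  have "coords 0 = 0" using coords_add[of 0 0] by simp
  then show ?thesis by (induction S rule: infinite_finite_induct) (auto simp: coords_add)
qed

lemma coords_act: "coords (M.act P m) = V.act P (coords m)"
proof -
  have "coords (M.act P m) = V.act (map_poly (\<lambda>x. x) P) (coords m)"
    by (rule twisted_act_hom[OF M.twisted_module_axioms V.twisted_module_axioms])
      (simp_all add: coords_add coords_scale coords_tau)
  then show ?thesis by (simp only: map_poly_id')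
qed

lemma coords_basis: "coords (motive_basis j) = axis 1 (axis j 1)"
proof -
  have "V.act ((motive_basis j :: 'a motive) $ l) w = (if l = j then w else 0)" for l w
    by (simp add: motive_basis_def axis_def)
  then show ?thesis by (simp add: coords_def)
qed

lemma coords_tau_basis: "coords (motive_tau (motive_basis j)) = axis 2 (axis j 1)"
  by (auto simp: coords_tau coords_basis tau_coords_def vec_eq_iff axis_def forall_2)

lemma coords_gen: "coords (gen i) = axis (fst i) (axis (snd i) 1)"
  using exhaust_2[of "fst i"] by (auto simp: gen_def coords_basis coords_tau_basis)

text \<open>\<sigma> encodes the relation for \<open>T e\<^sub>j\<close> solved for
  \<open>\<tau>\<^sup>2 e\<^sub>j\<close>; inserting it back cancels the terms with \<theta> and
  with \<open>A\<close>.\<close>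

lemma coords_T_basis: "coords (motive_T_basis \<theta> A j) = fps_scale fps_X (axis 1 (axis j 1))"
  unfolding motive_T_basis_def coords_add coords_sum coords_scale coords_tau[of "motive_tau _"]
    coords_tau_basis coords_basis
  by (auto simp: vec_eq_iff tau_coords_def axis_def neq_one_iff_2 if_distrib[of "\<lambda>x. _ * x"]
      if_distrib[of tate_tau] cong: if_cong)

lemma V_act_scale_X: "V.act P (fps_scale fps_X w) = fps_scale fps_X (V.act P w)"
proof -
  have "fps_scale fps_X (V.act P w) = V.act (map_poly (\<lambda>x. x) P) (fps_scale fps_X w)"
    by (rule twisted_act_hom[OF V.twisted_module_axioms V.twisted_module_axioms])
      (simp_all add: fps_scale_simps \<sigma>_scale mult.commute)
  then show ?thesis by (simp only: map_poly_id')
qed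

lemma coords_T: "coords (mT m) = fps_scale fps_X (coords m)"
proof -
  have "coords (mT m) = (\<Sum>j\<in>UNIV. V.act (m $ j) (fps_scale fps_X (axis 1 (axis j 1))))"
    unfolding motive_T_def twisted_act_eq coords_sum coords_act coords_T_basis ..
  then show ?thesis by (simp add: V_act_scale_X coords_def fps_scale_sum)
qed

lemma coords_poly_act: "coords (T.act p m) = fps_scale (fps_of_poly p) (coords m)"
proof (induction p)
  case 0
  have "coords 0 = 0" using coords_add[of 0 0] by simp
  then show ?case by (simp add: vec_eq_iff)
next
  case (pCons a p)
  have "T.act (pCons a p) m = T.act (smult a 1 + pCons 0 p) m" by simp
  also have "\<dots> = motive_scale a m + mT (T.act p m)"
    unfolding T.act_add T.act_smult poly_act_T by simp
  finally show ?case
    using pCons.IH by (simp add: coords_add coords_scale coords_T fps_scale_simps fps_of_poly_pCons mult.commute)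
qed

end

section \<open>Bases of modules of power series\<close>

lemma F2_poly_simps:
  "F2_poly 0 = (0 :: 'a::field poly)" "F2_poly (pCons b g) = (pCons (of_bit b) (F2_poly g) :: 'a poly)"
  by (simp_all add: F2_poly_def map_poly_pCons)

lemma coeff_F2_poly: "coeff (F2_poly g) n = (of_bit (coeff g n) :: 'a::field)"
  by (simp add: F2_poly_def coeff_map_poly)

lemma F2_poly_add:
  assumes "CHAR('a::field) = 2"
  shows "F2_poly (g + h) = (F2_poly g + F2_poly h :: 'a poly)"
  unfolding poly_eq_iff coeff_add coeff_F2_poly of_bit_add_char_2[OF assms] by blast

lemma ex1_unique: "\<exists>!x. P x \<Longrightarrow> P a \<Longrightarrow> P b \<Longrightarrow> a = b"
  by blast

abbreviation F2_act :: "bit poly \<Rightarrow> 'a::field fps \<Rightarrow> 'a fps" where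
  "F2_act g \<equiv> fps_poly_act (F2_poly g)"

lemma F2_act_simps:
  "F2_act 0 f = 0" "F2_act g (f + f') = F2_act g f + F2_act g f'" "F2_act g 0 = 0"
  "F2_act (pCons b g) f = fps_const (of_bit b) * f + fps_X * F2_act g f"
  "F2_act [:b:] f = fps_const (of_bit b) * f"
  by (simp_all add: fps_poly_act_def F2_poly_simps fps_of_poly_pCons algebra_simps)

lemma F2_act_nth: "fps_nth (F2_act g f) n = (\<Sum>j\<le>n. of_bit (coeff g j) * fps_nth f (n - j))"
  by (simp add: fps_poly_act_def fps_mult_nth coeff_F2_poly atLeast0AtMost)

lemma F2_act_nth_0: "fps_nth (F2_act g f) 0 = of_bit (coeff g 0) * fps_nth f 0"
  by (simp add: fps_poly_act_def coeff_F2_poly)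

text \<open>The nonzero elements of \<open>R\<close> are meant to have only the valuations \<open>lo\<close> and \<open>hi\<close>, and to be
  liftable to series whose other coefficients are smaller. Arbitrary lifts of a basis of \<open>R\<close> need
  not generate \<open>S\<close> over the polynomials in \<open>T\<close>: a lift can be multiplied by \<open>1 + T\<close>.\<close>

locale series_module = valued_field ord for ord :: "'a::field \<Rightarrow> ereal" +
  fixes S :: "'a fps set" and R :: "'a set" and lo hi :: real
  assumes char_2: "CHAR('a) = 2"
    and S_0: "0 \<in> S" and S_add: "f \<in> S \<Longrightarrow> g \<in> S \<Longrightarrow> f + g \<in> S"
    and S_X: "fps_X * f \<in> S \<longleftrightarrow> f \<in> S"
    and S_tate: "S \<subseteq> tate ord"
    and finite_R: "finite R" and S_nth_0: "f \<in> S \<Longrightarrow> fps_nth f 0 \<in> R"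
    and lo_le_hi: "lo \<le> hi"
    and R_hi: "x \<in> R \<Longrightarrow> ereal hi < ord x \<Longrightarrow> x = 0"
    and lift: "x \<in> R \<Longrightarrow> \<exists>f\<in>S. fps_nth f 0 = x \<and> (\<forall>n\<ge>1. ereal lo < ord (fps_nth f n))"
    and lift_gap: "x \<in> R \<Longrightarrow> ereal lo < ord x
      \<Longrightarrow> \<exists>f\<in>S. fps_nth f 0 = x \<and> (\<forall>n\<ge>1. ereal hi < ord (fps_nth f n))"
begin

lemma uminus_eq [simp]: "- f = (f :: 'a fps)"
  by (simp add: fps_eq_iff uminus_CHAR_2[OF char_2])

lemma S_diff: "f \<in> S \<Longrightarrow> g \<in> S \<Longrightarrow> f - g \<in> S"
  using S_add[of f "- g"] by (simp add: diff_conv_add_uminus del: add_uminus_conv_diff)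

lemma S_sum: "(\<And>i. i \<in> I \<Longrightarrow> f i \<in> S) \<Longrightarrow> sum f I \<in> S"
  by (induction I rule: infinite_finite_induct) (auto intro: S_0 S_add)

lemma S_const: "f \<in> S \<Longrightarrow> fps_const (of_bit b) * f \<in> S"
  by (cases b) (auto simp: S_0)

lemma S_shift:
  assumes "f \<in> S" "fps_nth f 0 = 0"
  obtains g where "g \<in> S" "f = fps_X * g" "\<And>n. fps_nth g n = fps_nth f (Suc n)"
proof -
  have "f = fps_X * fps_shift 1 f" using assms(2) by (simp add: fps_eq_iff)
  with that assms(1) S_X show thesis by (metis fps_shift_nth Suc_eq_plus1)
qed

lemma R_eq: "R = (\<lambda>f. fps_nth f 0) ` S"
  using lift S_nth_0 by (fastforce simp: image_iff)

lemma F2_act_add: "F2_act (g + h) f = F2_act g f + F2_act h (f :: 'a fps)"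
  by (simp only: fps_poly_act_def F2_poly_add[OF char_2] fps_of_poly_add distrib_right)

text \<open>A family rather than a set: later the indices are elements of the tensor product and
  \<open>b\<close> is the coordinate map.\<close>

definition is_series_basis :: "'i set \<Rightarrow> ('i \<Rightarrow> 'a fps) \<Rightarrow> bool" where
  "is_series_basis I b \<longleftrightarrow> finite I \<and> b ` I \<subseteq> S \<and>
     (\<forall>f\<in>S. \<exists>!g. g \<in> I \<rightarrow>\<^sub>E UNIV \<and> f = (\<Sum>i\<in>I. F2_act (g i) (b i)))"

text \<open>By \<open>S_X\<close>, constant coefficients identify \<open>S\<close> modulo
  \<open>T\<close> with \<open>R\<close>, so a basis of \<open>S\<close> over the polynomials
  reduces to a basis of \<open>R\<close> over the field with two elements.\<close>

lemma card_series_basis: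
  assumes "is_series_basis I b"
  shows "2 ^ card I = card R"
proof -
  let ?E = "I \<rightarrow>\<^sub>E (UNIV :: bit set)"
  let ?c = "\<lambda>\<epsilon>. \<Sum>i\<in>I. fps_const (of_bit (\<epsilon> i)) * b i"
  have fin: "finite I" and b: "\<And>i. i \<in> I \<Longrightarrow> b i \<in> S"
    and unique: "\<And>f. f \<in> S \<Longrightarrow> \<exists>!g. g \<in> I \<rightarrow>\<^sub>E UNIV \<and> f = (\<Sum>i\<in>I. F2_act (g i) (b i))"
    using assms by (auto simp: is_series_basis_def)
  have c_in_S: "?c \<epsilon> \<in> S" for \<epsilon> by (intro S_sum S_const b)
  have "bij_betw (\<lambda>\<epsilon>. fps_nth (?c \<epsilon>) 0) ?E R"
    unfolding bij_betw_def
  proof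
    show "inj_on (\<lambda>\<epsilon>. fps_nth (?c \<epsilon>) 0) ?E"
    proof (rule inj_onI)
      fix \<epsilon> \<delta> assume E: "\<epsilon> \<in> ?E" "\<delta> \<in> ?E" and eq: "fps_nth (?c \<epsilon>) 0 = fps_nth (?c \<delta>) 0"
      have "?c \<epsilon> - ?c \<delta> \<in> S" by (intro S_diff c_in_S)
      moreover have "fps_nth (?c \<epsilon> - ?c \<delta>) 0 = 0" unfolding fps_sub_nth eq by simp
      ultimately obtain f where f: "f \<in> S" "?c \<epsilon> - ?c \<delta> = fps_X * f"
        using S_shift by blast
      then obtain g where g: "f = (\<Sum>i\<in>I. F2_act (g i) (b i))" using unique by blast
      \<comment> \<open>Two expansions of the same series: constants \<open>\<epsilon> i\<close> on
        one side, \<open>\<delta> i\<close> plus a multiple of \<open>T\<close> on the other.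
        Uniqueness identifies their constant coefficients.\<close>
      define h k where "h = (\<lambda>i\<in>I. [:\<epsilon> i:])" and "k = (\<lambda>i\<in>I. pCons (\<delta> i) (g i))"
      have h: "?c \<epsilon> = (\<Sum>i\<in>I. F2_act (h i) (b i))" by (simp add: h_def F2_act_simps)
      have "?c \<epsilon> = ?c \<delta> + fps_X * f" using f(2) by (simp add: algebra_simps)
      also have "\<dots> = (\<Sum>i\<in>I. F2_act (k i) (b i))"
        by (simp add: k_def F2_act_simps g sum.distrib sum_distrib_left)
      finally have k: "?c \<epsilon> = (\<Sum>i\<in>I. F2_act (k i) (b i))" .
      have "h \<in> I \<rightarrow>\<^sub>E UNIV" "k \<in> I \<rightarrow>\<^sub>E UNIV" by (auto simp: h_def k_def)
      with h k have "h \<in> I \<rightarrow>\<^sub>E UNIV \<and> ?c \<epsilon> = (\<Sum>i\<in>I. F2_act (h i) (b i))"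
        and "k \<in> I \<rightarrow>\<^sub>E UNIV \<and> ?c \<epsilon> = (\<Sum>i\<in>I. F2_act (k i) (b i))" by blast+
      then have "h = k" by (rule ex1_unique[OF unique[OF c_in_S]])
      have "\<epsilon> i = \<delta> i" if "i \<in> I" for i
        using fun_cong[OF \<open>h = k\<close>, of i] that by (simp add: h_def k_def)
      with E show "\<epsilon> = \<delta>" by (intro PiE_ext) auto
    qed
    show "(\<lambda>\<epsilon>. fps_nth (?c \<epsilon>) 0) ` ?E = R"
    proof (intro equalityI subsetI)
      fix x assume "x \<in> (\<lambda>\<epsilon>. fps_nth (?c \<epsilon>) 0) ` ?E"
      then show "x \<in> R" using S_nth_0[OF c_in_S] by blast
    next
      fix x assume "x \<in> R"
      then obtain f where f: "f \<in> S" "x = fps_nth f 0" using R_eq by blast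
      then obtain g where g: "f = (\<Sum>i\<in>I. F2_act (g i) (b i))" using unique by blast
      then have "x = fps_nth (?c (\<lambda>i\<in>I. coeff (g i) 0)) 0"
        unfolding f(2) by (simp add: fps_sum_nth F2_act_nth_0)
      then show "x \<in> (\<lambda>\<epsilon>. fps_nth (?c \<epsilon>) 0) ` ?E"
        by (intro image_eqI[where x = "\<lambda>i\<in>I. coeff (g i) 0"]) simp_all
    qed
  qed
  then have "card ?E = card R" by (rule bij_betw_same_card)
  moreover have "card (UNIV :: bit set) = 2"
  proof -
    have UNIV_bit: "(UNIV :: bit set) = {0, 1}" using bit.exhaust by auto
    show ?thesis unfolding UNIV_bit by simp
  qed
  ultimately show ?thesis using fin by (simp add: card_PiE)
qed

text \<open>Peeling off the constant coefficients by means of the series \<open>l w\<close>, \<open>w \<in> C\<close>, reduces the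
  bound on the coefficients from \<open>r\<close> to \<open>r'\<close>, as soon as all but finitely many of them satisfy
  the second bound.\<close>

lemma peel:
  assumes "C \<subseteq> B" "r \<le> r'" "r' < \<infinity>" and l: "\<And>w. w \<in> B \<Longrightarrow> l w \<in> S" "\<And>w. w \<in> B \<Longrightarrow> fps_nth (l w) 0 = w"
    and "finite B"
    and C: "\<And>x. x \<in> R \<Longrightarrow> r < ord x \<Longrightarrow> \<exists>\<epsilon>. x = (\<Sum>w\<in>C. of_bit (\<epsilon> w) * w)"
    and l_r: "\<And>w. w \<in> C \<Longrightarrow> r < ord w" "\<And>w n. w \<in> C \<Longrightarrow> n \<ge> 1 \<Longrightarrow> r' < ord (fps_nth (l w) n)"
    and base: "\<And>f. f \<in> S \<Longrightarrow> (\<And>n. r' < ord (fps_nth f n)) \<Longrightarrow> \<exists>g. f = (\<Sum>w\<in>B. F2_act (g w) (l w))"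
    and "f \<in> S" "\<And>n. r < ord (fps_nth f n)" "\<And>n. n \<ge> k \<Longrightarrow> r' < ord (fps_nth f n)"
  shows "\<exists>g. f = (\<Sum>w\<in>B. F2_act (g w) (l w))"
  using assms(11-13)
proof (induction k arbitrary: f)
  case 0
  then show ?case using base by blast
next
  case (Suc k)
  obtain \<epsilon> where \<epsilon>: "fps_nth f 0 = (\<Sum>w\<in>C. of_bit (\<epsilon> w) * w)"
    using C[OF S_nth_0] Suc.prems by blast
  \<comment> \<open>This combination has the constant coefficient of \<open>f\<close>, so
    \<open>f - h\<close> is divisible by \<open>T\<close> within \<open>S\<close>, and the quotient
    has one exceptional index less.\<close>
  define h where "h = (\<Sum>w\<in>C. fps_const (of_bit (\<epsilon> w)) * l w)"
  have "h \<in> S" unfolding h_def using l(1) \<open>C \<subseteq> B\<close> by (intro S_sum S_const) auto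
  have "fps_nth h 0 = fps_nth f 0"
    unfolding h_def \<epsilon> using l(2) \<open>C \<subseteq> B\<close> by (auto simp: fps_sum_nth intro!: sum.cong)
  then obtain q where q: "q \<in> S" "f - h = fps_X * q" "\<And>n. fps_nth q n = fps_nth (f - h) (Suc n)"
    using S_shift[OF S_diff[OF Suc.prems(1) \<open>h \<in> S\<close>]] by auto
  have h_r': "r' < ord (fps_nth h (Suc n))" for n
    unfolding h_def fps_sum_nth
  proof (rule ord_sum_gt)
    show "r' < ord (fps_nth (fps_const (of_bit (\<epsilon> w)) * l w) (Suc n))" if "w \<in> C" for w
      using l_r(2)[OF that, of "Suc n"] \<open>r' < \<infinity>\<close> by (cases "\<epsilon> w") auto
  qed fact
  have "\<exists>g. q = (\<Sum>w\<in>B. F2_act (g w) (l w))"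
  proof (rule Suc.IH)
    show "r < ord (fps_nth q n)" for n
      unfolding q(3) fps_sub_nth using Suc.prems(2) order_le_less_trans[OF \<open>r \<le> r'\<close> h_r'] by (rule ord_diff_gt)
    show "r' < ord (fps_nth q n)" if "n \<ge> k" for n
      unfolding q(3) fps_sub_nth using Suc.prems(3)[of "Suc n"] that by (intro ord_diff_gt h_r') auto
  qed fact
  then obtain g where g: "q = (\<Sum>w\<in>B. F2_act (g w) (l w))" by blast
  have "f = h + fps_X * q" using q(2) by (simp add: algebra_simps)
  also have "h = (\<Sum>w\<in>B. fps_const (of_bit (if w \<in> C then \<epsilon> w else 0)) * l w)"
    unfolding h_def by (rule sum.mono_neutral_cong_left) (use \<open>C \<subseteq> B\<close> \<open>finite B\<close> in auto)
  also have "\<dots> + fps_X * q = (\<Sum>w\<in>B. F2_act (pCons (if w \<in> C then \<epsilon> w else 0) (g w)) (l w))"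
    by (simp only: F2_act_simps g sum.distrib sum_distrib_left)
  finally show ?case
    by (intro exI[of _ "\<lambda>w. pCons (if w \<in> C then \<epsilon> w else 0) (g w)"])
qed

text \<open>Division by \<open>T\<close> shifts the coefficients and keeps the bound, so each of
  them in turn becomes a constant coefficient in \<open>R\<close> above \<open>hi\<close>.\<close>

lemma eq_0_if_ord_gt_hi:
  assumes "f \<in> S" "\<And>n. ereal hi < ord (fps_nth f n)"
  shows "f = 0"
proof -
  have "fps_nth f n = 0" for n
    using assms
  proof (induction n arbitrary: f)
    case 0
    then show ?case using R_hi[OF S_nth_0] by blast
  next
    case (Suc n)
    then have "fps_nth f 0 = 0" using R_hi[OF S_nth_0] by blast
    then obtain g where "g \<in> S" "\<And>n. fps_nth g n = fps_nth f (Suc n)"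
      using S_shift Suc.prems(1) by metis
    with Suc.IH[of g] Suc.prems(2) show ?case by simp
  qed
  then show ?thesis by (simp add: fps_eq_iff)
qed

lemma eventually_gt:
  assumes "f \<in> S"
  obtains k where "\<And>n. n \<ge> k \<Longrightarrow> ereal r < ord (fps_nth f n)"
proof -
  from assms S_tate have "(\<lambda>n. ord (fps_nth f n)) \<longlonglongrightarrow> \<infinity>" by (auto simp: tate_def)
  then have "\<forall>\<^sub>F n in sequentially. ereal r < ord (fps_nth f n)" unfolding tendsto_PInfty by blast
  with that show thesis unfolding eventually_sequentially by blast
qed

sublocale F2: vector_space "\<lambda>(b::bit) (x::'a). of_bit b * x"
proof
  show "of_bit b * (of_bit c * x) = of_bit (b * c) * x" for b c :: bit and x :: 'a
    by (cases b; cases c) auto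
  show "of_bit (b + c) * x = of_bit b * x + of_bit c * x" for b c :: bit and x :: 'a
    by (simp only: of_bit_add_char_2[OF char_2] distrib_right)
qed (simp_all add: distrib_left)

text \<open>The basis is adapted to the valuation: \<open>C\<close> spans the elements of
  \<open>R\<close> above \<open>lo\<close> and is extended to \<open>B\<close>. Peeling with all of
  \<open>B\<close> leads from arbitrary series to the bound \<open>lo\<close>, peeling with
  \<open>C\<close> alone from \<open>lo\<close> to \<open>hi\<close>, and series above
  \<open>hi\<close> vanish.\<close>

lemma exists_lifted_basis:
  obtains B l where "finite B" "l ` B \<subseteq> S" "\<And>w. w \<in> B \<Longrightarrow> fps_nth (l w) 0 = w"
    "\<not> F2.dependent B" "\<And>f. f \<in> S \<Longrightarrow> \<exists>g. f = (\<Sum>w\<in>B. F2_act (g w) (l w))"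
proof -
  let ?Rs = "{x \<in> R. ereal lo < ord x}"
  obtain C where C: "C \<subseteq> ?Rs" "\<not> F2.dependent C" "?Rs \<subseteq> F2.span C"
    using F2.maximal_independent_subset .
  obtain B where B: "C \<subseteq> B" "B \<subseteq> R" "\<not> F2.dependent B" "R \<subseteq> F2.span B"
    using F2.maximal_independent_subset_extend[of C R] C by auto
  have "finite B" using B(2) finite_R by (rule finite_subset)
  then have "finite C" using B(1) by (rule rev_finite_subset)
  have "\<exists>f. f \<in> S \<and> fps_nth f 0 = w \<and> (\<forall>n\<ge>1. ereal lo < ord (fps_nth f n))
    \<and> (w \<in> C \<longrightarrow> (\<forall>n\<ge>1. ereal hi < ord (fps_nth f n)))" if "w \<in> B" for w
  proof (cases "w \<in> C")
    case True
    then obtain f where "f \<in> S" "fps_nth f 0 = w" "\<forall>n\<ge>1. ereal hi < ord (fps_nth f n)"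
      using lift_gap[of w] C(1) by auto
    then show ?thesis using lo_le_hi order_le_less_trans[of "ereal lo" "ereal hi"] by auto
  next
    case False
    then show ?thesis using lift[of w] that B(2) by blast
  qed
  then have "\<exists>l. \<forall>w\<in>B. l w \<in> S \<and> fps_nth (l w) 0 = w \<and> (\<forall>n\<ge>1. ereal lo < ord (fps_nth (l w) n))
    \<and> (w \<in> C \<longrightarrow> (\<forall>n\<ge>1. ereal hi < ord (fps_nth (l w) n)))"
    by (intro bchoice) blast
  then obtain l where l: "\<And>w. w \<in> B \<Longrightarrow> l w \<in> S" "\<And>w. w \<in> B \<Longrightarrow> fps_nth (l w) 0 = w"
    "\<And>w n. w \<in> B \<Longrightarrow> n \<ge> 1 \<Longrightarrow> ereal lo < ord (fps_nth (l w) n)"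
    "\<And>w n. w \<in> C \<Longrightarrow> n \<ge> 1 \<Longrightarrow> ereal hi < ord (fps_nth (l w) n)"
    using B(1) by blast
  have span_hi: "\<exists>g. f = (\<Sum>w\<in>B. F2_act (g w) (l w))"
    if "f \<in> S" "\<And>n. ereal hi < ord (fps_nth f n)" for f
    using eq_0_if_ord_gt_hi[OF that] by (intro exI[of _ "\<lambda>_. 0"]) (simp add: F2_act_simps)
  have span_lo: "\<exists>g. f = (\<Sum>w\<in>B. F2_act (g w) (l w))"
    if f: "f \<in> S" "\<And>n. ereal lo < ord (fps_nth f n)" for f
  proof -
    \<comment> \<open>A restricted series has only finitely many coefficients at or below
      \<open>hi\<close>, so the peeling terminates.\<close>
    obtain k where k: "\<And>n. n \<ge> k \<Longrightarrow> ereal hi < ord (fps_nth f n)" using eventually_gt[OF f(1)] by blast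
    show ?thesis
    proof (rule peel[OF B(1) _ _ l(1,2) \<open>finite B\<close> _ _ l(4) span_hi f k])
      show "\<exists>\<epsilon>. x = (\<Sum>w\<in>C. of_bit (\<epsilon> w) * w)" if "x \<in> R" "ereal lo < ord x" for x
        using C(3) that F2.span_finite[OF \<open>finite C\<close>] by blast
    qed (use lo_le_hi C(1) in auto)
  qed
  have "\<exists>g. f = (\<Sum>w\<in>B. F2_act (g w) (l w))" if f: "f \<in> S" for f
  proof -
    obtain k where k: "\<And>n. n \<ge> k \<Longrightarrow> ereal lo < ord (fps_nth f n)" using eventually_gt[OF f] by blast
    show ?thesis
    proof (rule peel[where r = "-\<infinity>", OF subset_refl _ _ l(1,2) \<open>finite B\<close> _ _ l(3) span_lo f _ k])
      show "\<exists>\<epsilon>. x = (\<Sum>w\<in>B. of_bit (\<epsilon> w) * w)" if "x \<in> R" for x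
        using B(4) that F2.span_finite[OF \<open>finite B\<close>] by blast
    qed auto
  qed
  with that \<open>finite B\<close> l(1,2) B(3) show thesis by blast
qed

text \<open>Once the coefficients of all \<open>g w\<close> below degree \<open>n\<close> vanish,
  coefficient \<open>n\<close> of the relation is a linear relation between the constant
  coefficients \<open>w\<close>.\<close>

lemma lifted_basis_independent:
  assumes "finite B" "\<And>w. w \<in> B \<Longrightarrow> fps_nth (l w) 0 = w" "\<not> F2.dependent B"
    and "(\<Sum>w\<in>B. F2_act (g w) (l w)) = 0" "w \<in> B"
  shows "g w = 0"
proof -
  have "\<forall>w\<in>B. coeff (g w) n = 0" for n
  proof (induction n rule: less_induct)
    case (less n)
    have "fps_nth (F2_act (g w) (l w)) n = of_bit (coeff (g w) n) * w" if "w \<in> B" for w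
    proof -
      have "fps_nth (F2_act (g w) (l w)) n = (\<Sum>j\<in>{n}. of_bit (coeff (g w) j) * fps_nth (l w) (n - j))"
        unfolding F2_act_nth by (rule sum.mono_neutral_right) (use less.IH that in auto)
      then show ?thesis using assms(2)[OF that] by simp
    qed
    then have "(\<Sum>w\<in>B. of_bit (coeff (g w) n) * w) = fps_nth (\<Sum>w\<in>B. F2_act (g w) (l w)) n"
      unfolding fps_sum_nth by (intro sum.cong) auto
    also have "\<dots> = 0" unfolding assms(4) by (rule fps_zero_nth)
    finally have sum_0: "(\<Sum>w\<in>B. of_bit (coeff (g w) n) * w) = 0" .
    have "F2.dependent B" if "w \<in> B" "coeff (g w) n \<noteq> 0" for w
      unfolding F2.dependent_finite[OF assms(1)]
      by (rule exI[of _ "\<lambda>w. coeff (g w) n"]) (use sum_0 that in blast)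
    with assms(3) show ?case by blast
  qed
  with assms(5) show ?thesis by (simp add: poly_eq_iff)
qed

text \<open>Transport along a bijection; the intended \<open>J\<close> is \<open>H1\<close>, with
  its coordinate map as \<open>\<pi>\<close>.\<close>

lemma exists_series_basis:
  fixes \<pi> :: "'i \<Rightarrow> 'a fps"
  assumes "bij_betw \<pi> J S"
  obtains I where "I \<subseteq> J" "is_series_basis I \<pi>"
proof -
  obtain B l where B: "finite B" "l ` B \<subseteq> S" "\<And>w. w \<in> B \<Longrightarrow> fps_nth (l w) 0 = w"
    "\<not> F2.dependent B" "\<And>f. f \<in> S \<Longrightarrow> \<exists>g. f = (\<Sum>w\<in>B. F2_act (g w) (l w))"
    using exists_lifted_basis by blast
  define \<iota> where "\<iota> = inv_into J \<pi> \<circ> l"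
  define I where "I = \<iota> ` B"
  have \<iota>: "\<pi> (\<iota> w) = l w" "\<iota> w \<in> J" if "w \<in> B" for w
    using assms B(2) that unfolding \<iota>_def bij_betw_def by (auto intro: f_inv_into_f inv_into_into)
  then have "inj_on \<iota> B" using B(3) by (metis inj_onI)
  have sum_I: "(\<Sum>i\<in>I. F2_act (g i) (\<pi> i)) = (\<Sum>w\<in>B. F2_act (g (\<iota> w)) (l w))" for g
    unfolding I_def using \<iota>(1) by (simp add: sum.reindex[OF \<open>inj_on \<iota> B\<close>])
  have unique: "\<exists>!g. g \<in> I \<rightarrow>\<^sub>E UNIV \<and> f = (\<Sum>i\<in>I. F2_act (g i) (\<pi> i))" if "f \<in> S" for f
  proof (rule ex_ex1I)
    obtain g where g: "f = (\<Sum>w\<in>B. F2_act (g w) (l w))" using B(5) \<open>f \<in> S\<close> by blast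
    define h where "h = (\<lambda>i\<in>I. g (inv_into B \<iota> i))"
    have "h (\<iota> w) = g w" if "w \<in> B" for w
      using that \<open>inj_on \<iota> B\<close> by (simp add: h_def I_def)
    then have "f = (\<Sum>i\<in>I. F2_act (h i) (\<pi> i))"
      unfolding sum_I g by (intro sum.cong) auto
    then show "\<exists>g. g \<in> I \<rightarrow>\<^sub>E UNIV \<and> f = (\<Sum>i\<in>I. F2_act (g i) (\<pi> i))"
      by (intro exI[of _ h]) (auto simp: h_def)
  next
    fix g h
    assume "g \<in> I \<rightarrow>\<^sub>E UNIV \<and> f = (\<Sum>i\<in>I. F2_act (g i) (\<pi> i))"
      and "h \<in> I \<rightarrow>\<^sub>E UNIV \<and> f = (\<Sum>i\<in>I. F2_act (h i) (\<pi> i))"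
    then have g: "g \<in> I \<rightarrow>\<^sub>E UNIV" "f = (\<Sum>w\<in>B. F2_act (g (\<iota> w)) (l w))"
      and h: "h \<in> I \<rightarrow>\<^sub>E UNIV" "f = (\<Sum>w\<in>B. F2_act (h (\<iota> w)) (l w))" by (auto simp: sum_I)
    \<comment> \<open>In characteristic 2 the sum of two expansions of \<open>f\<close> expands
      \<open>f + f = 0\<close>, so independence applies to \<open>g + h\<close>.\<close>
    have "(\<Sum>w\<in>B. F2_act (g (\<iota> w) + h (\<iota> w)) (l w)) = f + f"
      unfolding F2_act_add sum.distrib using g(2) h(2) by simp
    also have "\<dots> = f - - f" by (simp only: diff_minus_eq_add)
    also have "\<dots> = 0" by simp
    finally have *: "g (\<iota> w) + h (\<iota> w) = 0" if "w \<in> B" for w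
      using lifted_basis_independent[OF B(1,3,4), of "\<lambda>w. g (\<iota> w) + h (\<iota> w)"] that by blast
    show "g = h"
    proof (rule PiE_ext[OF g(1) h(1)])
      fix i assume "i \<in> I"
      then have "g i + h i = 0" using * unfolding I_def by blast
      then have "g i = - h i" by (simp only: add_eq_0_iff2)
      also have "- h i = h i" by (simp add: poly_eq_iff)
      finally show "g i = h i" .
    qed
  qed
  show thesis
  proof (rule that)
    show "I \<subseteq> J" using \<iota>(2) by (auto simp: I_def)
    have "finite I" unfolding I_def using B(1) by (rule finite_imageI)
    moreover have "\<pi> ` I \<subseteq> S"
    proof
      fix f assume "f \<in> \<pi> ` I"
      then obtain w where "w \<in> B" "f = \<pi> (\<iota> w)" unfolding I_def by blast
      then show "f \<in> S" using \<iota>(1) B(2) by auto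
    qed
    ultimately show "is_series_basis I \<pi>"
      unfolding is_series_basis_def by (intro conjI ballI unique)
  qed
qed

end

section \<open>Restricted power series\<close>

context valued_field
begin

lemma tate_add: "f \<in> tate ord \<Longrightarrow> g \<in> tate ord \<Longrightarrow> f + g \<in> tate ord"
proof -
  assume fg: "f \<in> tate ord" "g \<in> tate ord"
  have "\<forall>\<^sub>F n in sequentially. ereal r < ord (fps_nth (f + g) n)" for r
  proof -
    have "\<forall>\<^sub>F n in sequentially. ereal r < ord (fps_nth f n)" "\<forall>\<^sub>F n in sequentially. ereal r < ord (fps_nth g n)"
      using fg unfolding tate_def tendsto_PInfty by blast+
    then show ?thesis by eventually_elim (simp add: ord_add_gt)
  qed
  then show ?thesis unfolding tate_def tendsto_PInfty by blast
qed

lemma tate_const_mult: "f \<in> tate ord \<Longrightarrow> fps_const c * f \<in> tate ord"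
proof -
  assume f: "f \<in> tate ord"
  have "\<forall>\<^sub>F n in sequentially. ereal r < ord (fps_nth (fps_const c * f) n)" for r
  proof (cases "c = 0")
    case False
    then obtain s where s: "ord c = ereal s" by (rule ord_finite)
    have "\<forall>\<^sub>F n in sequentially. ereal (r - s) < ord (fps_nth f n)"
      using f unfolding tate_def tendsto_PInfty by blast
    then show ?thesis
    proof eventually_elim
      case (elim n)
      then show ?case by (cases "ord (fps_nth f n)") (auto simp: ord_mult s)
    qed
  qed simp
  then show ?thesis unfolding tate_def tendsto_PInfty by blast
qed

lemma tate_X_mult_iff: "fps_X * f \<in> tate ord \<longleftrightarrow> f \<in> tate ord"
  unfolding tate_def mem_Collect_eq
  by (subst filterlim_sequentially_Suc[symmetric]) simp

lemma tate_0: "0 \<in> tate ord"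
  by (simp add: tate_def)

lemma tate_uminus: "f \<in> tate ord \<Longrightarrow> - f \<in> tate ord"
  by (simp add: tate_def)

lemma tate_diff: "f \<in> tate ord \<Longrightarrow> g \<in> tate ord \<Longrightarrow> f - g \<in> tate ord"
  using tate_add[of f "- g"] by (simp add: tate_uminus)

lemma tate_sum: "(\<And>i. i \<in> I \<Longrightarrow> f i \<in> tate ord) \<Longrightarrow> sum f I \<in> tate ord"
  by (induction I rule: infinite_finite_induct) (auto simp: tate_0 intro: tate_add)

lemma tate_linear_mult: "f \<in> tate ord \<Longrightarrow> (fps_X - fps_const d) * f \<in> tate ord"
  unfolding left_diff_distrib by (intro tate_diff tate_const_mult) (simp_all add: tate_X_mult_iff)

lemma tate_poly_act: "f \<in> tate ord \<Longrightarrow> fps_poly_act p f \<in> tate ord"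
proof (induction p)
  case 0
  then show ?case by (simp add: fps_poly_act_def tate_0)
next
  case (pCons a p)
  have "fps_poly_act (pCons a p) f = fps_const a * f + fps_X * fps_poly_act p f"
    by (simp add: fps_poly_act_def fps_of_poly_pCons algebra_simps)
  with pCons show ?case by (simp add: tate_add tate_const_mult tate_X_mult_iff)
qed

lemma tate_tau_in_tate: "f \<in> tate ord \<Longrightarrow> tate_tau f \<in> tate ord"
proof -
  assume f: "f \<in> tate ord"
  have "\<forall>\<^sub>F n in sequentially. ereal r < ord (fps_nth (tate_tau f) n)" for r
  proof -
    \<comment> \<open>The bound 0 guards against negative \<open>r\<close>: squaring doubles the
      valuation, which raises it only when it is positive.\<close>
    have "\<forall>\<^sub>F n in sequentially. ereal (max r 0) < ord (fps_nth f n)"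
      using f unfolding tate_def tendsto_PInfty by blast
    then show ?thesis
    proof eventually_elim
      case (elim n)
      then show ?case
        by (cases "ord (fps_nth f n)") (auto simp: tate_tau_def power2_eq_square ord_mult)
    qed
  qed
  then show ?thesis unfolding tate_def tendsto_PInfty by blast
qed

lemma ord_ge_of_square: "ereal r \<le> ord (y\<^sup>2) \<Longrightarrow> ereal (r / 2) \<le> ord y"
  by (cases "ord y") (auto simp: power2_eq_square ord_mult)

end

section \<open>The equation for the invariant elements\<close>

locale rank_four_motive = valued_field ord + motive_char_2 \<theta> A
  for ord :: "'a::field \<Rightarrow> ereal" and \<theta> :: 'a and A :: "'a ^ 2 ^ 2" +
  fixes a b c :: 'a and v :: real
  assumes A_entries: "A $ 1 $ 1 = a" "A $ 1 $ 2 = b" "A $ 2 $ 1 = c" "A $ 2 $ 2 = 0"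
    and root: "\<And>p :: 'a poly. degree p > 0 \<Longrightarrow> \<exists>x. poly p x = 0"
    and ord_\<theta>: "ord \<theta> = ereal (-1)" and ord_a: "ord a = ereal (-1)" and ord_c: "ord c = ereal v"
    and v: "0 \<le> v" "v < 2"
    and ord_k: "ereal (- (16/7) * v - 24/7) \<le> ord (\<theta>^2 / c + \<theta>^4 / c^4 - b^2)"
begin

lemma c_neq_0: "c \<noteq> 0" and \<theta>_neq_0: "\<theta> \<noteq> 0" and a_neq_0: "a \<noteq> 0"
  using ord_c ord_\<theta> ord_a by auto

lemma minus_eq_add: "x - y = x + (y :: 'a)"
  by (rule minus_CHAR_2[OF char_2])

lemma add_self: "x + x = (0 :: 'a)"
  using minus_eq_add[of x x] by simp

lemma pow4_add: "(x + y) ^ 4 = x ^ 4 + (y::'a) ^ 4"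
  by (rule freshmans_dream'[where n = 2]) (simp_all add: char_2)

section \<open>The eliminated additive polynomial and its Newton polygon\<close>

definition k :: 'a where "k = \<theta>^2 / c + \<theta>^4 / c^4 - b^2"

definition F :: "'a poly" where
  "F = monom (\<theta>^12 / c^4) 16 + monom (\<theta>^4 * a^4 / c^4) 8 + monom k 4 + monom (a / c) 2 + monom (1 / c) 1"

lemma poly_F: "poly F x = \<theta>^12 / c^4 * x^16 + \<theta>^4 * a^4 / c^4 * x^8 + k * x^4 + a / c * x^2 + x / c"
  by (simp add: F_def poly_monom)

text \<open>Elimination of \<open>y\<close>: the square of the second equation is expressed through \<open>y\<^sup>2\<close>, which
  the first equation gives.\<close>

lemma elimination:
  assumes "\<theta>^2 * x^4 + a * x^2 + c * y^2 + x = p"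
  shows "\<theta>^2 * y^4 + b * x^2 + y = q \<longleftrightarrow> poly F x = q^2 + p / c + \<theta>^4 * p^4 / c^4"
proof -
  have "c * y^2 = p - (\<theta>^2 * x^4 + a * x^2 + x)" using assms by (simp add: algebra_simps)
  then have cy: "c * y^2 = \<theta>^2 * x^4 + a * x^2 + x + p" by (simp only: minus_eq_add ac_simps)
  have y2: "y^2 = (\<theta>^2 * x^4 + a * x^2 + x + p) / c"
    unfolding cy[symmetric] using c_neq_0 by simp
  have y8: "y^8 = (\<theta>^8 * x^16 + a^4 * x^8 + x^4 + p^4) / c^4"
  proof -
    have "y^8 = (y^2)^4" by (simp flip: power_mult)
    also have "\<dots> = (\<theta>^8 * x^16 + a^4 * x^8 + x^4 + p^4) / c^4"
      unfolding y2 power_divide pow4_add power_mult_distrib by (simp flip: power_mult)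
    finally show ?thesis .
  qed
  have "(\<theta>^2 * y^4 + b * x^2 + y)^2 = \<theta>^4 * y^8 + b^2 * x^4 + y^2"
    unfolding square_add power_mult_distrib by (simp flip: power_mult)
  also have "\<dots> = \<theta>^12 / c^4 * x^16 + \<theta>^4 * a^4 / c^4 * x^8 + (\<theta>^2 / c + \<theta>^4 / c^4 + b^2) * x^4
      + a / c * x^2 + x / c + p / c + \<theta>^4 * p^4 / c^4"
    unfolding y2 y8 by (simp add: add_divide_distrib distrib_left distrib_right flip: power_add)
  also have "\<dots> = poly F x + p / c + \<theta>^4 * p^4 / c^4"
    by (simp add: poly_F k_def minus_eq_add)
  finally have sq: "(\<theta>^2 * y^4 + b * x^2 + y)^2 = poly F x + p / c + \<theta>^4 * p^4 / c^4" .
  \<comment> \<open>Squaring is injective in characteristic 2, so the squared second equation is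
    equivalent to the original one.\<close>
  have "\<theta>^2 * y^4 + b * x^2 + y = q \<longleftrightarrow> (\<theta>^2 * y^4 + b * x^2 + y)^2 = q^2"
  proof
    assume "(\<theta>^2 * y^4 + b * x^2 + y)^2 = q^2"
    then have "(\<theta>^2 * y^4 + b * x^2 + y + q)^2 = 0"
      using square_add[of "\<theta>^2 * y^4 + b * x^2 + y" q] by (simp add: add_self)
    then have "\<theta>^2 * y^4 + b * x^2 + y - q = 0" by (simp add: minus_eq_add)
    then show "\<theta>^2 * y^4 + b * x^2 + y = q" by simp
  qed simp
  also have "\<dots> \<longleftrightarrow> poly F x + p / c + \<theta>^4 * p^4 / c^4 = q^2" unfolding sq ..
  also have "\<dots> \<longleftrightarrow> poly F x = q^2 - (p / c + \<theta>^4 * p^4 / c^4)" by (auto simp: algebra_simps)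
  also have "\<dots> \<longleftrightarrow> poly F x = q^2 + p / c + \<theta>^4 * p^4 / c^4" by (simp only: minus_eq_add add.assoc)
  finally show ?thesis .
qed

lemma coeff_F: "coeff F 16 = \<theta>^12 / c^4" "coeff F 8 = \<theta>^4 * a^4 / c^4" "coeff F 4 = k"
  "coeff F 2 = a / c" "coeff F 1 = 1 / c" "coeff F 0 = 0"
  by (simp_all add: F_def)

lemma degree_F: "degree F = 16"
proof (rule antisym)
  show "degree F \<le> 16"
    unfolding F_def by (intro degree_add_le order_trans[OF degree_monom_le]) auto
  show "16 \<le> degree F" using coeff_F(1) c_neq_0 \<theta>_neq_0 by (intro le_degree) simp
qed

lemma ord_coeff_F:
  "ord (coeff F 16) = ereal (-12 - 4 * v)" "ord (coeff F 8) = ereal (-8 - 4 * v)"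
  "ereal (- (16/7) * v - 24/7) \<le> ord (coeff F 4)"
  "ord (coeff F 2) = ereal (-1 - v)" "ord (coeff F 1) = ereal (- v)"
proof -
  have 1: "ord 1 = ereal 0" by simp
  have c4: "ord (c^4) = ereal (4 * v)" using ord_power[OF ord_c, of 4] by simp
  have t: "ord (\<theta> ^ n) = ereal (- real n)" and a4: "ord (a ^ n) = ereal (- real n)" for n
    using ord_power[OF ord_\<theta>, of n] ord_power[OF ord_a, of n] by simp_all
  have ta: "ord (\<theta> ^ 4 * a ^ 4) = ereal (-8)" by (simp add: ord_mult t a4)
  show "ord (coeff F 16) = ereal (-12 - 4 * v)" using ord_divide[OF t[of 12] c4] by (simp add: coeff_F)
  show "ord (coeff F 8) = ereal (-8 - 4 * v)" using ord_divide[OF ta c4] by (simp add: coeff_F)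
  show "ereal (- (16/7) * v - 24/7) \<le> ord (coeff F 4)" using ord_k by (simp add: coeff_F k_def)
  show "ord (coeff F 2) = ereal (-1 - v)" using ord_divide[OF ord_a ord_c] by (simp add: coeff_F)
  show "ord (coeff F 1) = ereal (- v)" using ord_divide[OF 1 ord_c] by (simp only: coeff_F) simp
qed

definition R :: "'a set" where "R = {x. poly F x = 0}"

text \<open>All exponents of \<open>F\<close> except 1 are even, so its derivative is the nonzero
  constant \<open>1 / c\<close> and all roots are simple.\<close>

lemma card_R: "card R = 16"
proof -
  have "of_nat n = (0::'a)" if "even n" for n
    using that of_nat_eq_0_iff_char_dvd[of n, where 'a = 'a] char_2 by simp
  from this[of 16] this[of 8] this[of 4] this[of 2]
  have "pderiv F = [:1 / c:]"
    unfolding F_def pderiv_add pderiv_monom by (simp add: monom_0)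
  then have "card {x. poly F x = 0} = degree F"
    using degree_F c_neq_0 by (intro card_roots_eq_degree root) auto
  then show ?thesis by (simp add: R_def degree_F)
qed

lemma finite_R: "finite R"
  using card_R by (auto intro: card_ge_0_finite)

text \<open>Up to sign, the slope of the Newton polygon between degrees 1 and 8; the segment from 8
  to 16 gives 1/2. The bound assumed on \<open>ord k\<close> is exactly the height of the first
  segment at degree 4.\<close>

definition \<alpha> :: real where "\<alpha> = (8 + 3 * v) / 7"

text \<open>Away from these two values one term would be strictly dominant: degree 16 below 1/2,
  degree 8 between 1/2 and \<alpha>, degree 1 above \<alpha>.\<close>

lemma ord_root_cases:
  assumes "x \<in> R" "x \<noteq> 0"
  shows "ord x = ereal (1/2) \<or> ord x = ereal \<alpha>"
proof -
  obtain \<rho> where \<rho>: "ord x = ereal \<rho>" using assms(2) by (rule ord_finite)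
  let ?I = "{1, 2, 4, 8, 16} :: nat set"
  let ?f = "\<lambda>i. coeff F i * x ^ i"
  have sum_0: "sum ?f ?I = 0"
    using assms(1) by (simp add: R_def poly_F coeff_F[unfolded One_nat_def] algebra_simps)
  have pow: "ord (x ^ i) = ereal (real i * \<rho>)" for i by (rule ord_power[OF \<rho>])
  have ords: "ord (?f 16) = ereal (-12 - 4 * v + 16 * \<rho>)" "ord (?f 8) = ereal (-8 - 4 * v + 8 * \<rho>)"
    "ord (?f 2) = ereal (-1 - v + 2 * \<rho>)" "ord (?f 1) = ereal (- v + \<rho>)"
    unfolding ord_mult pow ord_coeff_F by simp_all
  have ord4: "ereal (- (16/7) * v - 24/7 + 4 * \<rho>) \<le> ord (?f 4)"
    using pow[of 4] by (intro ord_mult_ge ord_coeff_F) simp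
  have \<alpha>: "7 * \<alpha> = 8 + 3 * v" by (simp add: \<alpha>_def)
  have dominant: "\<exists>j\<in>?I. j \<noteq> i \<and> ord (?f j) \<le> ord (?f i)" if "i \<in> {1, 8, 16}" for i
  proof -
    have "coeff F i \<noteq> 0"
      using that c_neq_0 a_neq_0 \<theta>_neq_0 by (auto simp: coeff_F coeff_F[unfolded One_nat_def])
    then have "?f i \<noteq> 0" using assms(2) by simp
    moreover have "i \<in> ?I" "finite ?I" using that by auto
    ultimately obtain j where "j \<in> ?I" "j \<noteq> i" "ord (?f j) \<le> ord (?f i)"
      using ord_dominant_term[of ?I i ?f, OF _ _ sum_0] by blast
    then show ?thesis by blast
  qed
  have ord4': "- (16/7) * v - 24/7 + 4 * \<rho> \<le> r" if "ord (?f 4) \<le> ereal r" for r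
    using order_trans[OF ord4 that] by simp
  consider "\<rho> < 1/2" | "\<rho> = 1/2" | "1/2 < \<rho>" "\<rho> < \<alpha>" | "\<rho> = \<alpha>" | "\<rho> > \<alpha>" by linarith
  then show ?thesis
  proof cases
    case 1
    from dominant[of 16] have "ord (?f 1) \<le> ord (?f 16) \<or> ord (?f 2) \<le> ord (?f 16)
      \<or> ord (?f 4) \<le> ord (?f 16) \<or> ord (?f 8) \<le> ord (?f 16)" by simp
    then show ?thesis unfolding ords ereal_less_eq(3) using 1 v by (auto dest: ord4')
  next
    case 3
    from dominant[of 8] have "ord (?f 1) \<le> ord (?f 8) \<or> ord (?f 2) \<le> ord (?f 8)
      \<or> ord (?f 4) \<le> ord (?f 8) \<or> ord (?f 16) \<le> ord (?f 8)" by simp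
    then show ?thesis unfolding ords ereal_less_eq(3) using 3 v \<alpha> by (auto dest: ord4')
  next
    case 5
    from dominant[of 1] have "ord (?f 2) \<le> ord (?f 1) \<or> ord (?f 4) \<le> ord (?f 1)
      \<or> ord (?f 8) \<le> ord (?f 1) \<or> ord (?f 16) \<le> ord (?f 1)" by simp
    then show ?thesis unfolding ords ereal_less_eq(3) using 5 v \<alpha> by (auto dest: ord4')
  qed (simp_all add: \<rho>)
qed

lemma exists_sqrt: "\<exists>y :: 'a. y\<^sup>2 = u"
proof -
  have "degree (monom 1 2 + [:u:] :: 'a poly) = 2"
    by (subst degree_add_eq_left) (simp_all add: degree_monom_eq)
  then obtain y where "poly (monom 1 2 + [:u:]) y = 0" using root[of "monom 1 2 + [:u:]"] by auto
  then have "y\<^sup>2 - u = 0" by (simp add: poly_monom minus_eq_add)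
  then show ?thesis by (intro exI[of _ y]) simp
qed

definition system :: "'a \<Rightarrow> 'a \<Rightarrow> 'a \<Rightarrow> 'a \<Rightarrow> bool" where
  "system p q x y \<longleftrightarrow> \<theta>^2 * x^4 + a * x^2 + c * y^2 + x = p \<and> \<theta>^2 * y^4 + b * x^2 + y = q"

lemma exists_system_solution:
  assumes "poly F x = q^2 + p / c + \<theta>^4 * p^4 / c^4"
  obtains y where "system p q x y" "y^2 = (\<theta>^2 * x^4 + a * x^2 + x + p) / c"
proof -
  obtain y where y: "y^2 = (\<theta>^2 * x^4 + a * x^2 + x + p) / c" using exists_sqrt by blast
  then have "c * y^2 = \<theta>^2 * x^4 + a * x^2 + x + p" using c_neq_0 by simp
  then have "\<theta>^2 * x^4 + a * x^2 + c * y^2 + x = (\<theta>^2 * x^4 + a * x^2 + x) + (\<theta>^2 * x^4 + a * x^2 + x) + p"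
    by (simp only: ac_simps)
  then have 1: "\<theta>^2 * x^4 + a * x^2 + c * y^2 + x = p" by (simp only: add_self add_0_left)
  with elimination[OF 1, of q] assms have "system p q x y" by (simp add: system_def)
  with y that show thesis by blast
qed

text \<open>For \<rho> \<ge> 1 the terms with \<open>x^4\<close> and \<open>x^2\<close> have
  valuation at least \<rho>, so that \<open>x\<close> and \<open>p\<close> decide; the threshold 1
  comes from \<open>a * x^2\<close>.\<close>

lemma ord_y_ge:
  assumes "y^2 = (\<theta>^2 * x^4 + a * x^2 + x + p) / c" "ereal \<rho> \<le> ord x" "\<rho> \<ge> 1" "\<mu> \<le> \<rho>" "ereal \<mu> \<le> ord p"
  shows "ereal ((\<mu> - v) / 2) \<le> ord y"
proof (rule ord_ge_of_square)
  have t: "ord (\<theta>^2) = ereal (-2)" using ord_power[OF ord_\<theta>, of 2] by simp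
  have le: "ereal \<mu> \<le> ord u" if "ereal r \<le> ord u" "\<mu> \<le> r" for r u
    using that by (meson ereal_less_eq(3) order_trans)
  have "ereal (-2 + 4 * \<rho>) \<le> ord (\<theta>^2 * x^4)" 
    using ord_power_ge[OF assms(2), of 4] t by (intro ord_mult_ge) auto
  moreover have "ereal (-1 + 2 * \<rho>) \<le> ord (a * x^2)"
    using ord_power_ge[OF assms(2), of 2] ord_a by (intro ord_mult_ge) auto
  ultimately have "ereal \<mu> \<le> ord (\<theta>^2 * x^4 + a * x^2 + x + p)"
    using assms by (intro ord_add_ge) (auto intro: le)
  then show "ereal (\<mu> - v) \<le> ord (y^2)" unfolding assms(1) by (rule ord_divide_ge) (rule ord_c)
qed

section \<open>Growth of valuations along the recursion\<close>

text \<open>The gain of \<open>1 + \<xi> / 2\<close> over \<xi> at the threshold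
  \<open>\<xi> = (v + 2) / 2\<close> of the case distinction in \<open>step\<close>; below it the
  gain is larger.\<close>

definition \<delta> :: real where "\<delta> = (2 - v) / 4"

text \<open>The bound on \<open>y\<close> is the one that gives \<open>c * y^2\<close> valuation at
  least \<xi>, as \<open>ord_y_ge\<close> yields for \<open>\<mu> = \<xi>\<close>.\<close>

definition region :: "real \<Rightarrow> 'a \<Rightarrow> 'a \<Rightarrow> bool" where
  "region \<xi> x y \<longleftrightarrow> ereal \<xi> \<le> ord x \<and> ereal ((\<xi> - v) / 2) \<le> ord y"

lemma step:
  assumes "region \<xi> x y" "\<xi> \<ge> 1/2"
  obtains x' y' where "system (x^4) (y^4) x' y'" "region (\<xi> + \<delta>) x' y'"
proof -
  define w where "w = (y^4)^2 + x^4 / c + \<theta>^4 * (x^4)^4 / c^4"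
  define P where "P = F + [:w:]"
  have x: "ereal \<xi> \<le> ord x" and y: "ereal ((\<xi> - v) / 2) \<le> ord y" using assms(1) by (auto simp: region_def)
  have x4: "ereal (4 * \<xi>) \<le> ord (x^4)" using ord_power_ge[OF x, of 4] by simp
  have le: "ereal \<mu> \<le> ord u" if "ereal r \<le> ord u" "\<mu> \<le> r" for r u \<mu>
    using that by (meson ereal_less_eq(3) order_trans)
  \<comment> \<open>The term \<open>y^8\<close> sets this bound: in the second term division by
    \<open>c\<close> costs only \<open>v\<close>, and the last term reaches it as soon as
    \<open>\<xi> \<ge> 1/3\<close>.\<close>
  have w: "ereal (4 * \<xi> - 4 * v) \<le> ord w"
    unfolding w_def
  proof (intro ord_add_ge)
    show "ereal (4 * \<xi> - 4 * v) \<le> ord ((y^4)^2)"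
    proof -
      have eqs: "real 8 * ((\<xi> - v) / 2) = 4 * \<xi> - 4 * v" "(y^4)^2 = y^8" by (simp_all flip: power_mult)
      show ?thesis using ord_power_ge[OF y, of 8] unfolding eqs .
    qed
    show "ereal (4 * \<xi> - 4 * v) \<le> ord (x^4 / c)"
      by (rule le[OF ord_divide_ge[OF x4 ord_c]]) (use v in simp)
    have "ereal (-4) \<le> ord (\<theta>^4)" "ord (c^4) = ereal (4 * v)"
      using ord_power[OF ord_\<theta>, of 4] ord_power[OF ord_c, of 4] by simp_all
    moreover have "ereal (16 * \<xi>) \<le> ord ((x^4)^4)" using ord_power_ge[OF x4, of 4] by simp
    ultimately have "ereal (-4 + 16 * \<xi> - 4 * v) \<le> ord (\<theta>^4 * (x^4)^4 / c^4)"
      by (intro ord_divide_ge ord_mult_ge)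
    then show "ereal (4 * \<xi> - 4 * v) \<le> ord (\<theta>^4 * (x^4)^4 / c^4)" by (rule le) (use assms(2) in simp)
  qed
  have coeff_P: "coeff P 0 = w" "\<And>i. i > 0 \<Longrightarrow> coeff P i = coeff F i"
    by (auto simp: P_def coeff_F coeff_pCons split: nat.splits)
  have "\<exists>x' \<rho>. poly P x' = 0 \<and> ereal \<rho> \<le> ord x' \<and> 1 \<le> \<rho> \<and> \<xi> + \<delta> \<le> \<rho>"
  \<comment> \<open>The coefficients of degree 1 and 8 yield roots of valuation at least
    \<open>4 * \<xi> - 3 * v\<close> and \<open>1 + \<xi> / 2\<close>. The former gains \<delta>
    from the threshold on, the latter below it.\<close>
  proof (cases "\<xi> \<ge> (v + 2) / 2")
    case True
    have "ereal (- v + real 1 * (4 * \<xi> - 3 * v)) \<le> ord (coeff P 0)"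
      using w unfolding coeff_P by (rule le) simp
    then obtain x' where "poly P x' = 0" "ereal (4 * \<xi> - 3 * v) \<le> ord x'"
      using exists_root_of_large_ord[of P 1 "- v" "4 * \<xi> - 3 * v", OF root] coeff_P(2)[of 1] ord_coeff_F(5)
      by auto
    moreover have "1 \<le> 4 * \<xi> - 3 * v" "\<xi> + \<delta> \<le> 4 * \<xi> - 3 * v"
      using True v by (simp_all add: \<delta>_def field_simps)
    ultimately show ?thesis by blast
  next
    case False
    have "ereal (- 8 - 4 * v + real 8 * (1 + \<xi> / 2)) \<le> ord (coeff P 0)"
      using w unfolding coeff_P by (rule le) simp
    then obtain x' where "poly P x' = 0" "ereal (1 + \<xi> / 2) \<le> ord x'"
      using exists_root_of_large_ord[of P 8 "- 8 - 4 * v" "1 + \<xi> / 2", OF root] coeff_P(2)[of 8] ord_coeff_F(2)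
      by auto
    moreover have "1 \<le> 1 + \<xi> / 2" "\<xi> + \<delta> \<le> 1 + \<xi> / 2"
      using False v assms(2) by (simp_all add: \<delta>_def field_simps)
    ultimately show ?thesis by blast
  qed
  then obtain x' \<rho> where x': "poly P x' = 0" "ereal \<rho> \<le> ord x'" "1 \<le> \<rho>" "\<xi> + \<delta> \<le> \<rho>" by blast
  have "poly F x' - w = 0" using x'(1) by (simp add: P_def minus_eq_add)
  then have "poly F x' = w" by simp
  then obtain y' where y': "system (x^4) (y^4) x' y'" "y'^2 = (\<theta>^2 * x'^4 + a * x'^2 + x' + x^4) / c"
    using exists_system_solution unfolding w_def by blast
  have "ereal (\<xi> + \<delta>) \<le> ord (x^4)" using x4 by (rule le) (use assms(2) v in \<open>simp add: \<delta>_def\<close>)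
  then have "ereal ((\<xi> + \<delta> - v) / 2) \<le> ord y'" by (rule ord_y_ge[OF y'(2) x'(2-4)])
  moreover have "ereal (\<xi> + \<delta>) \<le> ord x'" using x'(2,4) by (rule le)
  ultimately show thesis using y'(1) that unfolding region_def by blast
qed

text \<open>Starting data for the recursion. For valuation \<alpha> the bound on \<open>y\<close>
  comes from \<open>ord_y_ge\<close>, as \<alpha> \<ge> 1; valuation 1/2 is too small for that
  lemma, and the second equation is used instead.\<close>

lemma kernel_region:
  assumes "x \<in> R"
  obtains y where "system 0 0 x y" "region (1/2) x y" "ereal (1/2) < ord x \<Longrightarrow> region \<alpha> x y"
proof -
  have "poly F x = 0^2 + 0 / c + \<theta>^4 * 0^4 / c^4" using assms by (simp add: R_def)
  then obtain y where y: "system 0 0 x y" "y^2 = (\<theta>^2 * x^4 + a * x^2 + x + 0) / c"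
    using exists_system_solution[of x 0 0] by blast
  have \<alpha>: "\<alpha> \<ge> 1" using v by (simp add: \<alpha>_def)
  have x: "ereal (1/2) \<le> ord x" and x_\<alpha>: "ereal (1/2) < ord x \<Longrightarrow> ereal \<alpha> \<le> ord x"
    using ord_root_cases[OF assms] \<alpha> by (cases "x = 0"; auto)+
  have "region \<alpha> x y" if "ereal (1/2) < ord x"
    unfolding region_def using x_\<alpha>[OF that] ord_y_ge[OF y(2) x_\<alpha>[OF that] \<alpha>, of \<alpha>] by simp
  moreover have "region (1/2) x y"
  proof (rule ccontr)
    assume "\<not> ?thesis"
    with x have not_le: "\<not> ereal ((1/2 - v) / 2) \<le> ord y" by (simp add: region_def)
    then have "y \<noteq> 0" by auto
    then obtain \<eta> where \<eta>: "ord y = ereal \<eta>" by (rule ord_finite)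
    with not_le have \<eta>': "\<eta> < (1/2 - v) / 2" by simp
    \<comment> \<open>By definition of \<open>k\<close>, \<open>b^2\<close> is a combination of
      three terms of valuation at least \<open>-4 - 4 * v\<close>.\<close>
    have b: "ereal (-2 - 2 * v) \<le> ord b"
    proof -
      have t: "ord (\<theta>^n) = ereal (- real n)" for n using ord_power[OF ord_\<theta>, of n] by simp
      have c4: "ord (c^4) = ereal (4 * v)" using ord_power[OF ord_c, of 4] by simp
      have "ereal (-4 - 4 * v) \<le> ord (\<theta>^2 / c + \<theta>^4 / c^4 - k)"
      proof (intro ord_diff_ge ord_add_ge)
        show "ereal (-4 - 4 * v) \<le> ord (\<theta>^2 / c)" using ord_divide[OF t[of 2] ord_c] v by simp
        show "ereal (-4 - 4 * v) \<le> ord (\<theta>^4 / c^4)" using ord_divide[OF t[of 4] c4] by simp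
        show "ereal (-4 - 4 * v) \<le> ord k"
          by (rule order_trans[OF _ ord_coeff_F(3)[unfolded coeff_F]]) (use v in simp)
      qed
      then have "ereal (-4 - 4 * v) \<le> ord (b^2)" by (simp add: k_def)
      moreover have "(-4 - 4 * v) / 2 = -2 - 2 * v" by simp
      ultimately show ?thesis using ord_ge_of_square by metis
    qed
    \<comment> \<open>These are the terms of the second equation; for \<open>y\<close> below the
      bound, \<open>\<theta>^2 * y^4\<close> would be strictly dominant.\<close>
    let ?f = "\<lambda>i::nat. if i = 0 then \<theta>^2 * y^4 else if i = 1 then b * x^2 else y"
    have f0: "ord (\<theta>^2 * y^4) = ereal (-2 + 4 * \<eta>)"
      using ord_power[OF ord_\<theta>, of 2] ord_power[OF \<eta>, of 4] by (simp add: ord_mult)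
    then have "\<theta>^2 * y^4 \<noteq> 0" by auto
    moreover have "sum ?f {0, 1, 2} = 0" using y(1) by (simp add: system_def add.assoc)
    ultimately obtain j where j: "j \<in> {0, 1, 2}" "j \<noteq> 0" "ord (?f j) \<le> ord (?f 0)"
      using ord_dominant_term[of "{0, 1, 2}" 0 ?f] by auto
    have "ereal (-2 - 2 * v + 2 * (1/2)) \<le> ord (b * x^2)"
      using ord_power_ge[OF x, of 2] b by (intro ord_mult_ge) auto
    with j f0 \<eta> have "-2 - 2 * v + 2 * (1/2) \<le> -2 + 4 * \<eta> \<or> \<eta> \<le> -2 + 4 * \<eta>"
      by (auto dest: order_trans)
    then show False using \<eta>' v by auto
  qed
  ultimately show thesis using that y(1) by blast
qed


lemma chain:
  assumes "region \<xi> x\<^sub>0 y\<^sub>0" "\<xi> \<ge> 1/2"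
  obtains x y where "x 0 = x\<^sub>0" "y 0 = y\<^sub>0" "\<And>n. region (\<xi> + real n * \<delta>) (x n) (y n)"
    "\<And>n. system ((x n)^4) ((y n)^4) (x (Suc n)) (y (Suc n))"
proof -
  have "\<delta> > 0" using v by (simp add: \<delta>_def)
  \<comment> \<open>The implication pins the chosen sequence to the given initial pair.\<close>
  let ?P = "\<lambda>n z. region (\<xi> + real n * \<delta>) (fst z) (snd z) \<and> (n = 0 \<longrightarrow> z = (x\<^sub>0, y\<^sub>0))"
  let ?Q = "\<lambda>(n::nat) z z'. system ((fst z)^4) ((snd z)^4) (fst z') (snd z')"
  have step': "\<exists>z'. ?P (Suc n) z' \<and> ?Q n z z'" if z: "?P n z" for n z
  proof -
    have "0 \<le> real n * \<delta>" using \<open>\<delta> > 0\<close> by simp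
    then have "\<xi> + real n * \<delta> \<ge> 1/2" using assms(2) by linarith
    then obtain x' y' where "system ((fst z)^4) ((snd z)^4) x' y'" "region (\<xi> + real n * \<delta> + \<delta>) x' y'"
      using step[of "\<xi> + real n * \<delta>" "fst z" "snd z"] z by blast
    moreover have "\<xi> + real n * \<delta> + \<delta> = \<xi> + real (Suc n) * \<delta>" by (simp add: algebra_simps)
    ultimately show ?thesis by (intro exI[of _ "(x', y')"]) simp
  qed
  obtain z where z: "\<And>n. ?P n (z n)" "\<And>n. ?Q n (z n) (z (Suc n))"
    using dependent_nat_choice[of ?P ?Q] step' assms(1) by fastforce
  show thesis
  proof (rule that[of "\<lambda>n. fst (z n)" "\<lambda>n. snd (z n)"])
    show "fst (z 0) = x\<^sub>0" "snd (z 0) = y\<^sub>0" using z(1)[of 0] by auto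
  qed (use z in auto)
qed

section \<open>Solutions in restricted power series\<close>

text \<open>What \<open>\<sigma> z = z\<close> demands of the coordinates \<open>f\<close>,
  \<open>g\<close> at \<open>\<tau> e\<^sub>1\<close>, \<open>\<tau> e\<^sub>2\<close> after the
  other two are eliminated.\<close>

definition fps_system :: "'a fps \<Rightarrow> 'a fps \<Rightarrow> bool" where
  "fps_system f g \<longleftrightarrow>
     fps_const (\<theta>^2) * tate_tau (tate_tau f) + fps_const a * tate_tau f + fps_const c * tate_tau g + f
       = fps_X * tate_tau (tate_tau f) \<and>
     fps_const (\<theta>^2) * tate_tau (tate_tau g) + fps_const b * tate_tau f + g
       = fps_X * tate_tau (tate_tau g)"

lemma tate_tau_nth: "fps_nth (tate_tau f) n = (fps_nth f n)^2"
  by (simp add: tate_tau_def)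

lemma fps_system_iff:
  "fps_system f g \<longleftrightarrow> (\<forall>n. system (if n = 0 then 0 else (fps_nth f (n - 1))^4)
     (if n = 0 then 0 else (fps_nth g (n - 1))^4) (fps_nth f n) (fps_nth g n))"
  by (simp add: fps_system_def system_def fps_eq_iff tate_tau_nth flip: power_mult) blast

text \<open>Only \<open>f\<close> is recorded, because it determines \<open>g\<close> by
  \<open>fps_system_unique\<close>; this gives the set of single series that
  \<open>series_module\<close> expects.\<close>

definition solutions :: "'a fps set" where
  "solutions = {f \<in> tate ord. \<exists>g\<in>tate ord. fps_system f g}"

lemma fps_system_add: "fps_system f g \<Longrightarrow> fps_system f' g' \<Longrightarrow> fps_system (f + f') (g + g')"
proof -
  assume fg: "fps_system f g" "fps_system f' g'"
  have "fps_const (\<theta>^2) * tate_tau (tate_tau (f + f')) + fps_const a * tate_tau (f + f')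
        + fps_const c * tate_tau (g + g') + (f + f')
      = (fps_const (\<theta>^2) * tate_tau (tate_tau f) + fps_const a * tate_tau f + fps_const c * tate_tau g + f)
        + (fps_const (\<theta>^2) * tate_tau (tate_tau f') + fps_const a * tate_tau f' + fps_const c * tate_tau g' + f')"
    by (simp add: tate_tau_add algebra_simps)
  moreover have "fps_const (\<theta>^2) * tate_tau (tate_tau (g + g')) + fps_const b * tate_tau (f + f') + (g + g')
      = (fps_const (\<theta>^2) * tate_tau (tate_tau g) + fps_const b * tate_tau f + g)
        + (fps_const (\<theta>^2) * tate_tau (tate_tau g') + fps_const b * tate_tau f' + g')"
    by (simp add: tate_tau_add algebra_simps)
  ultimately show ?thesis using fg unfolding fps_system_def by (simp add: tate_tau_add distrib_left)
qed

lemma fps_system_X: "fps_system (fps_X * f) (fps_X * g) \<longleftrightarrow> fps_system f g"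
proof -
  have "fps_const (\<theta>^2) * tate_tau (tate_tau (fps_X * f)) + fps_const a * tate_tau (fps_X * f)
        + fps_const c * tate_tau (fps_X * g) + fps_X * f
      = fps_X * (fps_const (\<theta>^2) * tate_tau (tate_tau f) + fps_const a * tate_tau f + fps_const c * tate_tau g + f)"
    "fps_const (\<theta>^2) * tate_tau (tate_tau (fps_X * g)) + fps_const b * tate_tau (fps_X * f) + fps_X * g
      = fps_X * (fps_const (\<theta>^2) * tate_tau (tate_tau g) + fps_const b * tate_tau f + g)"
    by (simp_all add: tate_tau_mult algebra_simps)
  then show ?thesis unfolding fps_system_def by (simp add: tate_tau_mult)
qed

lemma kernel_nth_0:
  assumes "fps_system f g"
  shows "fps_nth f 0 \<in> R" "fps_nth f 0 = 0 \<Longrightarrow> fps_nth g 0 = 0"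
proof -
  let ?x = "fps_nth f 0" and ?y = "fps_nth g 0"
  from assms have s: "system 0 0 ?x ?y" unfolding fps_system_iff by (auto dest: spec[of _ 0])
  then show "?x \<in> R" using elimination[of ?x ?y 0 0] by (simp add: system_def R_def)
  show "?y = 0" if "?x = 0" using s that c_neq_0 by (simp add: system_def)
qed

text \<open>The bounds from \<open>chain\<close> grow by \<delta> at each index, which gives both
  convergence of the coefficients to 0 and a strict gain over \<xi> from index 1 on.\<close>

lemma lift_solution:
  assumes "system 0 0 x\<^sub>0 y\<^sub>0" "region \<xi> x\<^sub>0 y\<^sub>0" "\<xi> \<ge> 1/2"
  shows "\<exists>f\<in>solutions. fps_nth f 0 = x\<^sub>0 \<and> (\<forall>n\<ge>1. ereal \<xi> < ord (fps_nth f n))"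
proof -
  obtain x y where xy: "x 0 = x\<^sub>0" "y 0 = y\<^sub>0" "\<And>n. region (\<xi> + real n * \<delta>) (x n) (y n)"
    "\<And>n. system ((x n)^4) ((y n)^4) (x (Suc n)) (y (Suc n))"
    using chain[OF assms(2,3)] by blast
  have "\<delta> > 0" using v by (simp add: \<delta>_def)
  have x: "ereal (\<xi> + real n * \<delta>) \<le> ord (x n)" and y: "ereal ((\<xi> + real n * \<delta> - v) / 2) \<le> ord (y n)" for n
    using xy(3) by (auto simp: region_def)
  \<comment> \<open>Stated with half the growth rate, as available for \<open>y\<close>; the
    stronger bound on \<open>x\<close> is weakened to this form.\<close>
  have tate: "Abs_fps h \<in> tate ord" if "\<And>n. ereal ((real n * \<delta> + C) / 2) \<le> ord (h n)" for h C
    unfolding tate_def tendsto_PInfty mem_Collect_eq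
  proof
    fix r :: real
    obtain N :: nat where "real N > (2 * r - C) / \<delta>" using reals_Archimedean2 by blast
    then have N: "2 * r - C < real N * \<delta>" using \<open>\<delta> > 0\<close> by (simp add: field_simps)
    have "ereal r < ord (fps_nth (Abs_fps h) n)" if "n \<ge> N" for n
    proof -
      have "real N * \<delta> \<le> real n * \<delta>" using that \<open>\<delta> > 0\<close> by simp
      then have "ereal r < ereal ((real n * \<delta> + C) / 2)" using N by simp
      also have "\<dots> \<le> ord (h n)" by fact
      finally show ?thesis by simp
    qed
    then show "\<forall>\<^sub>F n in sequentially. ereal r < ord (fps_nth (Abs_fps h) n)"
      by (rule eventually_sequentiallyI)
  qed
  have "Abs_fps y \<in> tate ord"
    by (rule tate[where C = "\<xi> - v"]) (use y in \<open>simp add: algebra_simps\<close>)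
  moreover have "Abs_fps x \<in> tate ord"
  proof (rule tate[where C = "2 * \<xi>"])
    fix n
    have "0 \<le> real n * \<delta>" using \<open>\<delta> > 0\<close> by simp
    then have "ereal ((real n * \<delta> + 2 * \<xi>) / 2) \<le> ereal (\<xi> + real n * \<delta>)" by simp
    then show "ereal ((real n * \<delta> + 2 * \<xi>) / 2) \<le> ord (x n)" using x[of n] by (rule order_trans)
  qed
  moreover have "fps_system (Abs_fps x) (Abs_fps y)"
    unfolding fps_system_iff
  proof
    fix n
    show "system (if n = 0 then 0 else (fps_nth (Abs_fps x) (n - 1))^4)
      (if n = 0 then 0 else (fps_nth (Abs_fps y) (n - 1))^4) (fps_nth (Abs_fps x) n) (fps_nth (Abs_fps y) n)"
      using xy(1,2,4) assms(1) by (cases n) simp_all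
  qed
  moreover have "ereal \<xi> < ord (x n)" if "n \<ge> 1" for n
  proof -
    have "0 < real n * \<delta>" using that \<open>\<delta> > 0\<close> by (intro mult_pos_pos) auto
    then have "ereal \<xi> < ereal (\<xi> + real n * \<delta>)" by simp
    then show ?thesis using x[of n] by (rule order_less_le_trans)
  qed
  ultimately show ?thesis
    unfolding solutions_def by (intro bexI[of _ "Abs_fps x"] conjI CollectI bexI[of _ "Abs_fps y"]) (simp_all add: xy(1))
qed

text \<open>The two valuations of roots serve as \<open>lo\<close> and \<open>hi\<close>;
  \<open>kernel_region\<close> supplies starting points for both, which \<open>lift_solution\<close>
  extends to series.\<close>

sublocale S: series_module ord solutions R "1/2" \<alpha>
proof
  have \<alpha>: "1/2 \<le> \<alpha>" using v by (simp add: \<alpha>_def)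
  show "CHAR('a) = 2" by (rule char_2)
  show "0 \<in> solutions"
    unfolding solutions_def using tate_0 by (auto intro!: bexI[of _ 0] simp: fps_system_def)
  show "f + g \<in> solutions" if "f \<in> solutions" "g \<in> solutions" for f g
    using that fps_system_add tate_add unfolding solutions_def by blast
  show "fps_X * f \<in> solutions \<longleftrightarrow> f \<in> solutions" for f
  proof
    assume "fps_X * f \<in> solutions"
    then obtain g where g: "fps_X * f \<in> tate ord" "g \<in> tate ord" "fps_system (fps_X * f) g"
      unfolding solutions_def by blast
    \<comment> \<open>The companion \<open>g\<close> must be divisible by \<open>T\<close> as well
      before both can be divided.\<close>
    then have "fps_nth g 0 = 0" using kernel_nth_0(2)[OF g(3)] by simp
    then have "g = fps_X * fps_shift 1 g" by (simp add: fps_eq_iff)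
    with g show "f \<in> solutions" unfolding solutions_def using tate_X_mult_iff fps_system_X
      by (metis (mono_tags, lifting) mem_Collect_eq)
  next
    assume "f \<in> solutions"
    then show "fps_X * f \<in> solutions" unfolding solutions_def using tate_X_mult_iff fps_system_X by blast
  qed
  show "solutions \<subseteq> tate ord" by (auto simp: solutions_def)
  show "finite R" by (rule finite_R)
  show "fps_nth f 0 \<in> R" if "f \<in> solutions" for f
    using that kernel_nth_0(1) by (auto simp: solutions_def)
  show "1/2 \<le> \<alpha>" by (rule \<alpha>)
  show "x = 0" if "x \<in> R" "ereal \<alpha> < ord x" for x
    using ord_root_cases[OF that(1)] that(2) \<alpha> by (cases "x = 0") auto
  show "\<exists>f\<in>solutions. fps_nth f 0 = x \<and> (\<forall>n\<ge>1. ereal (1/2) < ord (fps_nth f n))" if "x \<in> R" for x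
    using kernel_region[OF that] lift_solution by (metis order_refl)
  show "\<exists>f\<in>solutions. fps_nth f 0 = x \<and> (\<forall>n\<ge>1. ereal \<alpha> < ord (fps_nth f n))"
    if "x \<in> R" "ereal (1/2) < ord x" for x
    using kernel_region[OF that(1)] lift_solution that(2) \<alpha> by metis
qed

section \<open>Transfer to the tensor product\<close>

text \<open>The four elements \<open>gen i\<close> generate and have unit vectors as coordinates, so
  \<open>m \<otimes> n \<mapsto> n \<cdot> coords m\<close> identifies the tensor product with
  vectors of four restricted series.\<close>

sublocale tensor: free_tensor "motive_poly_act \<theta> A" fps_poly_act "tate ord"
  "\<lambda>m n. fps_scale n (coords m)" UNIV gen
proof
  show "\<exists>r. m = (\<Sum>i\<in>UNIV. motive_poly_act \<theta> A (r i) (gen i))" for m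
    using span_UNIV[of m] unfolding span_def motive_poly_act_eq by blast
  show "fps_poly_act r n \<in> tate ord" if "n \<in> tate ord" for r n
    using that by (rule tate_poly_act)
  fix d :: "2 \<times> 2 \<Rightarrow> 'a fps" and i
  assume *: "(\<Sum>i\<in>UNIV. fps_scale (d i) (coords (gen i))) = 0"
  have "fps_scale (d j) (coords (gen j)) $ fst i $ snd i = (if j = i then d j else 0)" for j
    by (auto simp: coords_gen axis_def prod_eq_iff)
  then have "(\<Sum>j\<in>UNIV. fps_scale (d j) (coords (gen j))) $ fst i $ snd i = d i"
    by (simp add: sum_component)
  with * show "d i = 0" by simp
qed (auto simp: tate_0 tate_add tate_uminus tate_poly_act coords_add fps_scale_simps coords_poly_act
    motive_poly_act_eq fps_poly_act_def mult.commute)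

lemma tensor_elements: "tensor.elements = {z. \<forall>i j. z $ i $ j \<in> tate ord}"
proof -
  have comp: "(\<Sum>j\<in>UNIV. fps_scale (d j) (coords (gen j))) $ k $ l = d (k, l)" for d k l
  proof -
    have "fps_scale (d j) (coords (gen j)) $ k $ l = (if j = (k, l) then d j else 0)" for j
      by (auto simp: coords_gen axis_def prod_eq_iff)
    then show ?thesis by (simp add: sum_component)
  qed
  show ?thesis
  proof (intro equalityI subsetI)
    fix z assume "z \<in> tensor.elements"
    then obtain d where d: "z = (\<Sum>j\<in>UNIV. fps_scale (d j) (coords (gen j)))" "\<forall>j. d j \<in> tate ord"
      unfolding tensor.elements_def by auto
    show "z \<in> {z. \<forall>i j. z $ i $ j \<in> tate ord}" unfolding d(1) mem_Collect_eq comp using d(2) by blast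
  next
    fix z :: "'a fps ^ 2 ^ 2" assume z: "z \<in> {z. \<forall>i j. z $ i $ j \<in> tate ord}"
    have "z = (\<Sum>j\<in>UNIV. fps_scale (z $ fst j $ snd j) (coords (gen j)))"
      unfolding vec_eq_iff comp[of "\<lambda>j. z $ fst j $ snd j"] by simp
    with z show "z \<in> tensor.elements"
      unfolding tensor.elements_def mem_Collect_eq
      by (intro exI[of _ "\<lambda>j. z $ fst j $ snd j"]) blast
  qed
qed

lemma motive_tate_tau_fibre:
  assumes "z \<in> tensor.elements"
  shows "motive_tate_tau ord \<theta> A (tensor.fibre z) = tensor.fibre (\<sigma> z)"
  unfolding motive_tate_tau_def
proof (rule tensor.tensor_map_fibre[OF assms])
  have minus: "\<sigma> (- z) = - \<sigma> z" for z
    using \<sigma>_add[of z "- z"] V.zero_simps(3) by (simp add: eq_neg_iff_add_eq_0 add.commute)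
  show "\<sigma> (x - y) = \<sigma> x - \<sigma> y" for x y
    using \<sigma>_add[of x "- y"] minus by simp
qed (simp_all add: tate_tau_in_tate coords_tau \<sigma>_scale)

lemma motive_tate_act_fibre:
  assumes "z \<in> tensor.elements"
  shows "motive_tate_act ord \<theta> A g (tensor.fibre z) = tensor.fibre (fps_scale (fps_of_poly (F2_poly g)) z)"
  unfolding motive_tate_act_def
  by (rule tensor.tensor_map_fibre[OF assms tate_poly_act])
    (simp_all add: fps_poly_act_def vec_eq_iff algebra_simps)

definition fixed :: "('a fps ^ 2 ^ 2) set" where
  "fixed = {z \<in> tensor.elements. \<sigma> z = z}"

text \<open>Since \<sigma> preserves restricted series, injectivity of the fibre map turns
  invariance of a coset into \<open>\<sigma> z = z\<close>.\<close>

lemma H1_eq: "H1 ord \<theta> A = tensor.fibre ` fixed"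
proof -
  have "\<sigma> z \<in> tensor.elements" if "z \<in> tensor.elements" for z
  proof -
    have "tate_tau (z $ k $ j) \<in> tate ord" for k j
      using that by (auto simp: tensor_elements tate_tau_in_tate)
    then show ?thesis
      by (auto simp: tensor_elements tau_coords_def intro!: tate_linear_mult tate_diff tate_sum tate_const_mult)
  qed
  then show ?thesis
    unfolding H1_def motive_tate_def tensor.carrier_tensor_product fixed_def
    using inj_onD[OF tensor.inj_on_fibre] by (auto simp: motive_tate_tau_fibre)
qed

text \<open>The components at \<open>e\<^sub>j\<close> give the first condition; substituted into
  those at \<open>\<tau> e\<^sub>j\<close>, it leaves equations in \<open>z $ 2\<close> alone, where
  \<tau> has turned \<theta> into \<open>\<theta>^2\<close>.\<close>

lemma fixed_iff:
  "\<sigma> z = z \<longleftrightarrow> (\<forall>j. z $ 1 $ j = (fps_X - fps_const \<theta>) * tate_tau (z $ 2 $ j)) \<and> fps_system (z $ 2 $ 1) (z $ 2 $ 2)"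
proof -
  let ?f = "z $ 2 $ 1" and ?g = "z $ 2 $ 2"
  have tt: "tate_tau ((fps_X - fps_const \<theta>) * tate_tau h) = fps_X * tate_tau (tate_tau h) - fps_const (\<theta>^2) * tate_tau (tate_tau h)" for h
  proof -
    have "tate_tau (fps_X - fps_const \<theta>) = fps_X - fps_const (\<theta>^2)"
    proof -
      have minus: "f - g = f + g" for f g :: "'a fps" by (simp add: fps_eq_iff minus_eq_add)
      show ?thesis unfolding minus tate_tau_add by simp
    qed
    then show ?thesis unfolding tate_tau_mult by (simp only: left_diff_distrib)
  qed
  have "\<sigma> z = z \<longleftrightarrow> (\<forall>j. z $ 1 $ j = (fps_X - fps_const \<theta>) * tate_tau (z $ 2 $ j)) \<and>
      tate_tau (z $ 1 $ 1) - (fps_const a * tate_tau ?f + fps_const c * tate_tau ?g) = ?f \<and>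
      tate_tau (z $ 1 $ 2) - fps_const b * tate_tau ?f = ?g"
    by (auto simp: vec_eq_iff tau_coords_def forall_2 sum_2 A_entries)
  also have "\<dots> \<longleftrightarrow> (\<forall>j. z $ 1 $ j = (fps_X - fps_const \<theta>) * tate_tau (z $ 2 $ j)) \<and> fps_system ?f ?g"
  proof (rule conj_cong[OF refl])
    assume "\<forall>j. z $ 1 $ j = (fps_X - fps_const \<theta>) * tate_tau (z $ 2 $ j)"
    then have t: "tate_tau (z $ 1 $ j) = fps_X * tate_tau (tate_tau (z $ 2 $ j))
        - fps_const (\<theta>^2) * tate_tau (tate_tau (z $ 2 $ j))" for j
      by (simp only: tt)
    show "(tate_tau (z $ 1 $ 1) - (fps_const a * tate_tau ?f + fps_const c * tate_tau ?g) = ?f \<and>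
      tate_tau (z $ 1 $ 2) - fps_const b * tate_tau ?f = ?g) = fps_system ?f ?g"
      unfolding fps_system_def t by (auto simp: algebra_simps)
  qed
  finally show ?thesis .
qed

text \<open>The first equation determines \<open>c * tate_tau g\<close>, \<open>c\<close> is
  nonzero, and squaring is injective on coefficients.\<close>

lemma fps_system_unique: "fps_system f g \<Longrightarrow> fps_system f g' \<Longrightarrow> g = g'"
proof -
  assume "fps_system f g" "fps_system f g'"
  then have "fps_const c * tate_tau g = fps_const c * tate_tau g'"
    unfolding fps_system_def by (metis add_left_cancel add_right_cancel)
  then have "tate_tau g = tate_tau g'" using c_neq_0 by simp
  then have "(fps_nth g n)^2 = (fps_nth g' n)^2" for n
    unfolding tate_tau_nth[symmetric] by simp
  then have "(fps_nth g n + fps_nth g' n)^2 = 0" for n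
    by (simp add: square_add add_self)
  then have "fps_nth g n - fps_nth g' n = 0" for n by (simp add: minus_eq_add)
  then show ?thesis by (simp add: fps_eq_iff)
qed

lemma bij_fixed: "bij_betw (\<lambda>z. z $ 2 $ 1) fixed solutions"
  unfolding bij_betw_def
proof
  show "inj_on (\<lambda>z. z $ 2 $ 1) fixed"
  proof (rule inj_onI)
    fix z w assume zw: "z \<in> fixed" "w \<in> fixed" "z $ 2 $ 1 = w $ 2 $ 1"
    then have "fps_system (z $ 2 $ 1) (z $ 2 $ 2)" "fps_system (z $ 2 $ 1) (w $ 2 $ 2)"
      by (auto simp: fixed_def fixed_iff)
    then have "z $ 2 $ 2 = w $ 2 $ 2" by (rule fps_system_unique)
    with zw(3) have 2: "z $ 2 $ j = w $ 2 $ j" for j using exhaust_2[of j] by auto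
    moreover have "z $ 1 $ j = w $ 1 $ j" for j using zw(1,2) 2 by (auto simp: fixed_def fixed_iff)
    ultimately show "z = w" by (simp add: vec_eq_iff forall_2)
  qed
  show "(\<lambda>z. z $ 2 $ 1) ` fixed = solutions"
  proof (intro equalityI subsetI)
    fix f assume "f \<in> (\<lambda>z. z $ 2 $ 1) ` fixed"
    then show "f \<in> solutions" by (auto simp: fixed_def fixed_iff solutions_def tensor_elements)
  next
    fix f assume "f \<in> solutions"
    then obtain g where fg: "f \<in> tate ord" "g \<in> tate ord" "fps_system f g" unfolding solutions_def by blast
    define h where "h j = (if j = (1::2) then f else g)" for j
    define z where "z = (\<chi> k j. if k = (1::2) then (fps_X - fps_const \<theta>) * tate_tau (h j) else h j)"
    have h: "h j \<in> tate ord" for j using fg by (simp add: h_def)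
    have "(fps_X - fps_const \<theta>) * tate_tau (h j) \<in> tate ord" for j
      by (intro tate_linear_mult tate_tau_in_tate h)
    then have "z \<in> tensor.elements" using h by (simp add: tensor_elements z_def)
    moreover have "\<sigma> z = z" using fg(3) by (simp add: fixed_iff z_def h_def)
    moreover have "z $ 2 $ 1 = f" by (simp add: z_def h_def)
    ultimately show "f \<in> (\<lambda>z. z $ 2 $ 1) ` fixed" unfolding fixed_def by blast
  qed
qed

definition coord :: "'a motive_tensor \<Rightarrow> 'a fps" where
  "coord x = inv_into tensor.elements tensor.fibre x $ 2 $ 1"

lemma coord_fibre: "z \<in> tensor.elements \<Longrightarrow> coord (tensor.fibre z) = z $ 2 $ 1"
  by (simp add: coord_def inv_into_f_f[OF tensor.inj_on_fibre])

lemma bij_coord: "bij_betw coord (H1 ord \<theta> A) solutions"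
proof -
  have "fixed \<subseteq> tensor.elements" by (auto simp: fixed_def)
  then have "inj_on tensor.fibre fixed" using tensor.inj_on_fibre inj_on_subset by blast
  then have "bij_betw tensor.fibre fixed (H1 ord \<theta> A)" by (simp add: bij_betw_def H1_eq)
  moreover have "bij_betw (coord \<circ> tensor.fibre) fixed solutions"
    using bij_fixed by (rule bij_betw_cong[THEN iffD1, rotated]) (simp add: coord_fibre fixed_def)
  ultimately show ?thesis using bij_betw_comp_iff by blast
qed

text \<open>\<open>coord\<close> is a bijection from \<open>H1\<close> onto \<open>solutions\<close>
  that respects linear combinations over the polynomials with coefficients in the field with two
  elements, so expansions correspond.\<close>

lemma is_H1_basis_iff: "is_H1_basis ord \<theta> A B \<longleftrightarrow> B \<subseteq> H1 ord \<theta> A \<and> S.is_series_basis B coord"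
proof (cases "finite B \<and> B \<subseteq> H1 ord \<theta> A")
  case False
  then show ?thesis by (auto simp: is_H1_basis_def S.is_series_basis_def)
next
  case True
  have "\<forall>x\<in>B. \<exists>z. z \<in> fixed \<and> x = tensor.fibre z" using True H1_eq by blast
  then obtain z where z: "\<And>x. x \<in> B \<Longrightarrow> z x \<in> fixed" "\<And>x. x \<in> B \<Longrightarrow> tensor.fibre (z x) = x"
    by metis
  have elem: "z x \<in> tensor.elements" if "x \<in> B" for x using z(1)[OF that] by (simp add: fixed_def)
  have coord_z: "coord x = z x $ 2 $ 1" if "x \<in> B" for x
    using coord_fibre[OF elem[OF that]] z(2)[OF that] by simp
  define s where "s g = (\<Sum>x\<in>B. fps_scale (fps_of_poly (F2_poly (g x))) (z x))" for g
  have act_elem: "fps_scale (fps_of_poly (F2_poly g)) (z x) \<in> tensor.elements" if "x \<in> B" for g x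
    using elem[OF that] tate_poly_act by (auto simp: tensor_elements fps_poly_act_def)
  have finprod: "finprod (motive_tate ord \<theta> A) (\<lambda>b. motive_tate_act ord \<theta> A (g b) b) B = tensor.fibre (s g)" for g
  proof -
    have act: "motive_tate_act ord \<theta> A (g x) x = tensor.fibre (fps_scale (fps_of_poly (F2_poly (g x))) (z x))"
      if "x \<in> B" for x
      using motive_tate_act_fibre[OF elem[OF that], of "g x"] z(2)[OF that] by simp
    interpret G: comm_group "motive_tate ord \<theta> A"
      unfolding motive_tate_def by (rule tensor.comm_group_tensor_product)
    have "finprod (motive_tate ord \<theta> A) (\<lambda>b. motive_tate_act ord \<theta> A (g b) b) B
        = finprod (motive_tate ord \<theta> A) (\<lambda>x. tensor.fibre (fps_scale (fps_of_poly (F2_poly (g x))) (z x))) B"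
      by (rule G.finprod_cong')
        (auto simp: act motive_tate_def tensor.carrier_tensor_product act_elem)
    also have "\<dots> = tensor.fibre (s g)"
      unfolding motive_tate_def s_def using True act_elem by (intro tensor.finprod_tensor_product) auto
    finally show ?thesis .
  qed
  have s_elem: "s g \<in> tensor.elements" for g
    unfolding s_def by (intro tensor.sum_in_elements act_elem)
  have s_fixed: "s g \<in> fixed" for g
  proof -
    \<comment> \<open>Squaring fixes 0 and 1, so \<tau> fixes these polynomials and their
      combinations of invariant vectors stay invariant.\<close>
    have "tate_tau (fps_of_poly (F2_poly h)) = (fps_of_poly (F2_poly h) :: 'a fps)" for h
      by (simp add: fps_eq_iff tate_tau_nth coeff_F2_poly)
    then have "\<sigma> (s g) = s g"
      unfolding s_def V.F_sum \<sigma>_scale using z(1) by (intro sum.cong) (auto simp: fixed_def)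
    then show ?thesis using s_elem by (simp add: fixed_def)
  qed
  have coord_s: "coord (tensor.fibre (s g)) = (\<Sum>x\<in>B. F2_act (g x) (coord x))" for g
    by (subst coord_fibre[OF s_elem]) (simp add: s_def sum_component coord_z fps_poly_act_def)
  have eq_iff: "x = finprod (motive_tate ord \<theta> A) (\<lambda>b. motive_tate_act ord \<theta> A (g b) b) B
      \<longleftrightarrow> coord x = (\<Sum>x\<in>B. F2_act (g x) (coord x))" if "x \<in> H1 ord \<theta> A" for x g
  proof -
    have "tensor.fibre (s g) \<in> H1 ord \<theta> A" using s_fixed H1_eq by blast
    then show ?thesis
      unfolding finprod coord_s[symmetric]
      using that inj_on_eq_iff[OF bij_betw_imp_inj_on[OF bij_coord]] by blast
  qed
  have image: "coord ` H1 ord \<theta> A = solutions" using bij_coord by (simp add: bij_betw_def)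
  have "is_H1_basis ord \<theta> A B \<longleftrightarrow> (\<forall>x\<in>H1 ord \<theta> A. \<exists>!g. g \<in> B \<rightarrow>\<^sub>E UNIV \<and>
      x = finprod (motive_tate ord \<theta> A) (\<lambda>b. motive_tate_act ord \<theta> A (g b) b) B)"
    unfolding is_H1_basis_def using True by (elim conjE) (simp only: simp_thms)
  also have "\<dots> \<longleftrightarrow> (\<forall>x\<in>H1 ord \<theta> A. \<exists>!g. g \<in> B \<rightarrow>\<^sub>E UNIV \<and> coord x = (\<Sum>x\<in>B. F2_act (g x) (coord x)))"
    by (intro ball_cong refl) (simp only: eq_iff)
  also have "\<dots> \<longleftrightarrow> (\<forall>f\<in>solutions. \<exists>!g. g \<in> B \<rightarrow>\<^sub>E UNIV \<and> f = (\<Sum>x\<in>B. F2_act (g x) (coord x)))"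
    by (simp only: image[symmetric] ball_simps)
  also have "\<dots> \<longleftrightarrow> B \<subseteq> H1 ord \<theta> A \<and> S.is_series_basis B coord"
  proof -
    have "coord ` B \<subseteq> solutions" using image True by blast
    then show ?thesis
      unfolding S.is_series_basis_def using True by (elim conjE) (simp only: simp_thms)
  qed
  finally show ?thesis .
qed

text \<open>The description operator needs one basis to exist and all bases to have the same size;
  counting \<open>R\<close> gives \<open>2 ^ card B = 16\<close> for each.\<close>

lemma h1_eq_4: "h1 ord \<theta> A = 4"
  unfolding h1_def
proof (rule the_equality)
  have card_4: "card B = 4" if "is_H1_basis ord \<theta> A B" for B
  proof -
    have "2 ^ card B = (2::nat) ^ 4"
      using S.card_series_basis[of B coord] that card_R by (simp add: is_H1_basis_iff)
    then show ?thesis by (subst (asm) power_inject_exp) simp_all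
  qed
  obtain B where "B \<subseteq> H1 ord \<theta> A" "S.is_series_basis B coord"
    using S.exists_series_basis[OF bij_coord] by blast
  then have "is_H1_basis ord \<theta> A B" by (simp add: is_H1_basis_iff)
  with card_4 show "\<exists>B. is_H1_basis ord \<theta> A B \<and> card B = 4" by blast
  show "n = 4" if "\<exists>B. is_H1_basis ord \<theta> A B \<and> card B = n" for n
    using that card_4 by blast
qed

end

theorem proposition8p1:
  fixes ord :: "'a::field \<Rightarrow> ereal" and \<theta> a11 a12 a21 :: 'a
    and A :: "'a ^ 2 ^ 2" and v :: real and t :: ereal
  assumes "is_C_infinity ord \<theta>"
    and "A = vector [vector [a11, a12], vector [a21, 0]]"
    and "ord a11 = -1"
    and "a21 \<noteq> 0"
    and "ord a21 = ereal v"
    and "t = ord (\<theta>^2 / a21 + \<theta>^4 / a21^4 - a12^2)"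
    and "0 \<le> v" and "v < 2"
    and "t \<ge> ereal (- (16/7) * v - 24/7)"
  shows "h1 ord \<theta> A = 4"
proof -
  from assms(1) interpret valued_field ord
    by unfold_locales (simp add: is_C_infinity_def)
  from assms(1) have closed: "val_complete ord"
    "alg_closed_subfield (algebraic_over (val_closure ord (F2_rational \<theta>)))"
    "val_closure ord (algebraic_over (val_closure ord (F2_rational \<theta>))) = UNIV"
    by (simp_all add: is_C_infinity_def Let_def)
  interpret rank_four_motive ord \<theta> A a11 a12 a21 v
  proof unfold_locales
    show "CHAR('a) = 2" "ord \<theta> = ereal (-1)" using assms(1) by (simp_all add: is_C_infinity_def one_ereal_def)
    show "ord a11 = ereal (-1)" using assms(3) by (simp add: one_ereal_def)
    \<comment> \<open>The elements algebraic over the closure of the rational functions are dense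
      and algebraically closed, so by completeness the whole field is algebraically closed.\<close>
    show "\<exists>x. poly p x = 0" if "degree p > 0" for p :: "'a poly"
      using exists_root[OF closed(1,3,2) that] .
  qed (use assms in simp_all)
  show ?thesis by (rule h1_eq_4)
qed

end
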